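(* Let $f$ be a monic irreducible element of $R$ with $f\notin Z(R)$, whose bound is $F(x^n)$ with $F(y)\in\mathbb{K}[y]$ monic irreducible of degree $s$, $F(y)\neq y$, and assume $\deg f=s\ell$ where $\ell=\ell_F$. Let $\rho\in\mathrm{Aut}(\mathbb{L})$, $\mathbb{K}'=\mathrm{Fix}_{\mathbb{L}}(\rho)\cap\mathbb{K}$ with $\mathbb{K}/\mathbb{K}'$ finite, and let $\eta\in\mathbb{L}$ with $\mathrm{N}_{\mathbb{L}/\mathbb{K}'}(\eta f_0)\ne1$, where $f_0$ is the constant coefficient of $f$. On $R/Rf$, the operation $$\Big((a_0-\eta\rho(a_0)f_0)+\sum_{i=1}^{s\ell-1}a_ix^i\Big)\star_S\sum_{i=0}^{s\ell-1}b_ix^i:=\Big((a_0-\eta\rho(a_0)f_0)+\sum_{i=1}^{s\ell-1}a_ix^i+\eta\rho(a_0)f(x)\Big)\sum_{i=0}^{s\ell-1}b_ix^i \bmod_r f$$ ($a_i,b_i\in\mathbb{L}$) defines a division algebra over $\mathbb{K}'$ of dimension $m\ell^2s[\mathbb{K}:\mathbb{K}']$.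
   Context: $\mathbb{K}$ is a field, $\mathbb{L}/\mathbb{K}$ cyclic Galois of degree $n\ge2$, $\sigma$ a generator of $\mathrm{Gal}(\mathbb{L}/\mathbb{K})$, $R=\mathbb{L}[x;\sigma]$ with $xa=\sigma(a)x$; $Z(R)=\mathbb{K}[x^n]$. The bound of $f$ is the monic central polynomial $F(x^n)$ generating the largest two-sided ideal contained in $Rf$. $m=m_F$ is the number of irreducible factors of $F(x^n)$ in $R$ and $\ell_F=n/m$. $R/Rf$ is identified with polynomials of degree $<\deg f$, and $g\bmod_r f$ is the remainder of right division by $f$. Under the hypothesis on $\eta$ the map $y\mapsto y-\eta\rho(y)f_0$ is a bijection of $\mathbb{L}$, so each element of $R/Rf$ is uniquely of the form $(a_0-\eta\rho(a_0)f_0)+\sum_{i=1}^{s\ell-1}a_ix^i$. A (not necessarily associative) division algebra is a finite-dimensional algebra in which left and right multiplication by any nonzero element is bijective. *)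

theory Defs
  imports
    "HOL-Algebra.Algebraic_Closure_Type"
    "HOL-Algebra.Embedded_Algebras"
    "Jordan_Normal_Form.Determinant"
begin

(* The big field is the universe of a type 'a :: field.  Its subfields are sets, and degrees and
   dimensions are those of HOL-Algebra.Embedded_Algebras. *)

abbreviation type_ring :: "'a::field ring"
  where "type_ring \<equiv> ring_of_type_algebra"

definition galois_group :: "'a::field set \<Rightarrow> ('a \<Rightarrow> 'a) monoid"
  where "galois_group K =
    \<lparr>carrier = {\<tau> \<in> ring_iso type_ring type_ring. \<forall>k\<in>K. \<tau> k = k}, monoid.mult = (\<circ>), one = id\<rparr>"

definition galois_extension :: "'a::field set \<Rightarrow> bool"
  where "galois_extension K \<longleftrightarrow>
    subfield K type_ring \<and>
    ring.finite_dimension type_ring K UNIV \<and>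
    {a. \<forall>\<tau>\<in>carrier (galois_group K). \<tau> a = a} = K"

(* Determinant of left multiplication by a on the big field, viewed as a K-vector space;
   it does not depend on the chosen basis. *)
definition field_norm :: "'a::field set \<Rightarrow> 'a \<Rightarrow> 'a"
  where "field_norm K a = (THE d. \<exists>bs M.
    ring.independent type_ring K bs \<and> ring.Span type_ring K bs = UNIV \<and>
    M \<in> carrier_mat (length bs) (length bs) \<and>
    (\<forall>i<length bs. \<forall>j<length bs. M $$ (i, j) \<in> K) \<and>
    (\<forall>j<length bs. a * bs ! j = (\<Sum>i<length bs. M $$ (i, j) * bs ! i)) \<and>
    d = det M)"

definition poly_ring_over :: "'a::field set \<Rightarrow> 'a poly ring"
  where "poly_ring_over K = ring_of_type_algebra \<lparr>carrier := {p. \<forall>i. poly.coeff p i \<in> K}\<rparr>"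

(* The type 'a poly only supplies the additive group of the skew polynomial ring, with
   coefficients written on the left; x a = \<sigma>(a) x gives (a x^i) (b x^j) = a \<sigma>^i(b) x^(i+j). *)
definition skew_mult :: "('a::field \<Rightarrow> 'a) \<Rightarrow> 'a poly \<Rightarrow> 'a poly \<Rightarrow> 'a poly"
  where "skew_mult \<sigma> p q =
    (\<Sum>i\<le>Polynomial.degree p. \<Sum>j\<le>Polynomial.degree q.
      Polynomial.monom (poly.coeff p i * (\<sigma> ^^ i) (poly.coeff q j)) (i + j))"

definition skew_poly_ring :: "('a::field \<Rightarrow> 'a) \<Rightarrow> 'a poly ring"
  where "skew_poly_ring \<sigma> =
    \<lparr>carrier = UNIV, monoid.mult = skew_mult \<sigma>, one = 1, ring.zero = 0, add = (+)\<rparr>"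

lemma skew_mult_X_const:
  assumes "\<sigma> 0 = 0"
  shows "skew_mult \<sigma> [:0, 1:] [:a:] = skew_mult \<sigma> [:\<sigma> a:] [:0, 1:]"
  using assms by (simp add: skew_mult_def monom_Suc monom_0)

definition ring_center :: "('a, 'b) ring_scheme \<Rightarrow> 'a set"
  where "ring_center R =
    {z \<in> carrier R. \<forall>g\<in>carrier R. z \<otimes>\<^bsub>R\<^esub> g = g \<otimes>\<^bsub>R\<^esub> z}"

(* F(x^n); powers of x multiply as usual, so this commutative substitution has the right
   coefficients. *)
definition power_subst :: "nat \<Rightarrow> 'a::field poly \<Rightarrow> 'a poly"
  where "power_subst n F = pcompose F (Polynomial.monom 1 n)"

(* PIdl f is the left ideal R f, and ideal and Idl are two-sided. *)
definition is_bound :: "('a::field \<Rightarrow> 'a) \<Rightarrow> 'a poly \<Rightarrow> 'a poly \<Rightarrow> bool"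
  where "is_bound \<sigma> f B \<longleftrightarrow> (let R = skew_poly_ring \<sigma> in
    Polynomial.lead_coeff B = 1 \<and> B \<in> ring_center R \<and>
    Idl\<^bsub>R\<^esub> {B} \<subseteq> PIdl\<^bsub>R\<^esub> f \<and>
    (\<forall>I. ideal I R \<and> I \<subseteq> PIdl\<^bsub>R\<^esub> f \<longrightarrow> I \<subseteq> Idl\<^bsub>R\<^esub> {B}))"

(* Well defined in the skew polynomial ring, where any two factorizations into irreducibles
   have the same length.  The relations factors and irreducible are phrased through left factors;
   in a domain irreducibility still means: not a unit, and g h = a only if g or h is a unit. *)
definition num_irreducible_factors :: "('a, 'b) ring_scheme \<Rightarrow> 'a \<Rightarrow> nat"
  where "num_irreducible_factors R a =
    (THE m. \<exists>fs. set fs \<subseteq> carrier R \<and> factors R fs a \<and> length fs = m)"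

definition residue_polys :: "'a::field poly \<Rightarrow> 'a poly set"
  where "residue_polys f = {p. p = 0 \<or> Polynomial.degree p < Polynomial.degree f}"

definition skew_rem :: "('a::field \<Rightarrow> 'a) \<Rightarrow> 'a poly \<Rightarrow> 'a poly \<Rightarrow> 'a poly"
  where "skew_rem \<sigma> g f = (THE r. r \<in> residue_polys f \<and> (\<exists>q. g = skew_mult \<sigma> q f + r))"

definition star_mult ::
    "('a::field \<Rightarrow> 'a) \<Rightarrow> ('a \<Rightarrow> 'a) \<Rightarrow> 'a \<Rightarrow> 'a poly \<Rightarrow> 'a poly \<Rightarrow> 'a poly \<Rightarrow> 'a poly"
  where "star_mult \<sigma> \<rho> \<eta> f u b =
    (let a0 = (THE y. y - \<eta> * \<rho> y * poly.coeff f 0 = poly.coeff u 0)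
     in skew_rem \<sigma> (skew_mult \<sigma> (u + Polynomial.smult (\<eta> * \<rho> a0) f) b) f)"

lemma star_mult_eq:
  assumes "inj (\<lambda>y. y - \<eta> * \<rho> y * poly.coeff f 0)"
  shows "star_mult \<sigma> \<rho> \<eta> f
      ([:a 0 - \<eta> * \<rho> (a 0) * poly.coeff f 0:] + (\<Sum>i=1..<N. Polynomial.monom (a i) i)) b =
    skew_rem \<sigma> (skew_mult \<sigma>
      ([:a 0 - \<eta> * \<rho> (a 0) * poly.coeff f 0:] + (\<Sum>i=1..<N. Polynomial.monom (a i) i)
        + Polynomial.smult (\<eta> * \<rho> (a 0)) f) b) f"
proof -
  have "poly.coeff (\<Sum>i=1..<N. Polynomial.monom (a i) i) 0 = 0"
    by (simp add: coeff_sum)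
  moreover have "(THE y. y - \<eta> * \<rho> y * poly.coeff f 0 = a 0 - \<eta> * \<rho> (a 0) * poly.coeff f 0) = a 0"
    by (rule the_equality) (auto dest: injD[OF assms])
  ultimately show ?thesis
    unfolding star_mult_def Let_def by (simp only: coeff_add coeff_pCons_0 add_0_right)
qed

(* A not necessarily associative algebra with multiplication mul, whose underlying K-space is a
   subspace V of a ring R containing K; the scalars act by the left multiplication of R. *)
definition nonassoc_division_algebra ::
    "('a, 'b) ring_scheme \<Rightarrow> 'a set \<Rightarrow> 'a set \<Rightarrow> ('a \<Rightarrow> 'a \<Rightarrow> 'a) \<Rightarrow> bool"
  where "nonassoc_division_algebra R K V mul \<longleftrightarrow>
    ring R \<and> subfield K R \<and> subalgebra K V R \<and> ring.finite_dimension R K V \<and>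
    (\<forall>a\<in>V. \<forall>b\<in>V. mul a b \<in> V) \<and>
    (\<forall>a\<in>V. \<forall>b\<in>V. \<forall>c\<in>V. mul (a \<oplus>\<^bsub>R\<^esub> b) c = mul a c \<oplus>\<^bsub>R\<^esub> mul b c) \<and>
    (\<forall>a\<in>V. \<forall>b\<in>V. \<forall>c\<in>V. mul a (b \<oplus>\<^bsub>R\<^esub> c) = mul a b \<oplus>\<^bsub>R\<^esub> mul a c) \<and>
    (\<forall>k\<in>K. \<forall>a\<in>V. \<forall>b\<in>V. mul (k \<otimes>\<^bsub>R\<^esub> a) b = k \<otimes>\<^bsub>R\<^esub> mul a b) \<and>
    (\<forall>k\<in>K. \<forall>a\<in>V. \<forall>b\<in>V. mul a (k \<otimes>\<^bsub>R\<^esub> b) = k \<otimes>\<^bsub>R\<^esub> mul a b) \<and>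
    (\<forall>a \<in> V - {\<zero>\<^bsub>R\<^esub>}. bij_betw (mul a) V V \<and> bij_betw (\<lambda>b. mul b a) V V)"

end

(* Let b be nonzero modulo f.  As f is irreducible, the annihilator of b in R/Rf is R g with g monic of
   the same degree as f, and right multiplication by b identifies R/Rg with R/Rf.  If
   u + \<eta> \<rho>(a) f, whose constant coefficient is a, annihilates b, then it equals \<eta> \<rho>(a) g by degree
   reasons, so a = \<eta> \<rho>(a) g_0.  Left multiplication by x is K'-linear on R/Rg and on R/Rf; the two
   companion maps differ by a factor of determinant N(f_0/g_0), and are conjugate, so N(f_0) = N(g_0).
   Taking norms in a = \<eta> \<rho>(a) g_0 gives N(\<eta> f_0) = 1 unless u = 0.  Hence there are no zero divisors.

   For the dimension: the bound B is the annihilator of the simple module R/Rf, so splitting off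
   annihilators of elements of R/Rf one after another factors B into irreducibles of degree deg f;
   since B is central, every irreducible factor of B is a right factor and so has that degree too.
   Thus m deg f = deg B = n s, that is m l = n. *)
theory Submission
  imports Defs
begin

text \<open>R f is only a left ideal, so the residue of \<open>u \<cdot> b\<close> modulo f depends
  on the representative chosen for u. The product studied here picks u + \<eta> \<rho>(a) f, which
  may have full degree deg f, so simplicity of R/Rf alone does not exclude zero divisors; the norm
  condition does. Left multiplication by x is not linear over the big field, because x a =
  \<sigma>(a) x, and its determinant over K' would involve a sign and the determinant of \<sigma>.
  It is linear over K', which \<sigma> fixes, and comparing two companion maps instead of evaluating
  either makes these contributions cancel. The bound guarantees nonzero annihilators: B is central
  and lies in R f, hence kills all of R/Rf. The number m is a definite description over
  factorizations. Equal degrees of all irreducible factors of B make it well defined, and they show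
  that the truncated quotient n div m is exact.\<close>

hide_const (open) Module.smult UnivPoly.coeff UnivPoly.monom

section \<open>Arithmetic of skew polynomials\<close>

lemma smult_sum_right: "smult a (sum g A) = (\<Sum>i\<in>A. smult a (g i))"
  by (induction A rule: infinite_finite_induct) (auto simp: smult_add_right)

locale field_endo =
  fixes \<sigma> :: "'a::field \<Rightarrow> 'a"
  assumes endo_add: "\<sigma> (a + b) = \<sigma> a + \<sigma> b"
    and endo_mult: "\<sigma> (a * b) = \<sigma> a * \<sigma> b"
    and endo_one [simp]: "\<sigma> 1 = 1"
begin

lemma endo_zero [simp]: "\<sigma> 0 = 0"
  by (metis add.right_neutral add_left_cancel endo_add)

lemma endo_uminus: "\<sigma> (- a) = - \<sigma> a"
  using endo_add[of a "- a"] by (simp add: eq_neg_iff_add_eq_0 add.commute)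

lemma endo_diff: "\<sigma> (a - b) = \<sigma> a - \<sigma> b"
  using endo_add[of a "- b"] by (simp add: endo_uminus)

text \<open>Injectivity, applied to the powers of \<sigma>, keeps leading coefficients of products
  nonzero and lets \<open>right_division\<close> divide by them.\<close>

lemma endo_eq_0_iff [simp]: "\<sigma> a = 0 \<longleftrightarrow> a = 0"
proof
  assume "\<sigma> a = 0"
  then have "\<sigma> (a * inverse a) = 0"
    by (simp add: endo_mult)
  then show "a = 0"
    by (metis endo_one right_inverse zero_neq_one)
qed simp

lemma funpow_field_endo: "field_endo (\<sigma> ^^ i)"
  by (induction i) (unfold_locales, auto simp: endo_add endo_mult field_endo_def)

abbreviation skew_times (infixl "\<cdot>" 70)
  where "p \<cdot> q \<equiv> skew_mult \<sigma> p q"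

text \<open>\<open>skew_mult\<close> sums exactly up to the degrees, which drop when terms cancel.
  With free upper bounds several products can be summed over one common index range, and
  distributivity becomes termwise.\<close>

lemma skew_mult_bounded:
  assumes "degree p \<le> N" "degree q \<le> M"
  shows "p \<cdot> q = (\<Sum>i\<le>N. \<Sum>j\<le>M. monom (coeff p i * (\<sigma> ^^ i) (coeff q j)) (i + j))"
proof -
  interpret pow: field_endo "\<sigma> ^^ i" for i by (rule funpow_field_endo)
  have "p \<cdot> q = (\<Sum>i\<le>degree p. \<Sum>j\<le>M. monom (coeff p i * (\<sigma> ^^ i) (coeff q j)) (i + j))"
    unfolding skew_mult_def
    by (intro sum.cong refl sum.mono_neutral_left) (use assms in \<open>auto simp: coeff_eq_0\<close>)
  also have "\<dots> = (\<Sum>i\<le>N. \<Sum>j\<le>M. monom (coeff p i * (\<sigma> ^^ i) (coeff q j)) (i + j))"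
    by (intro sum.mono_neutral_left) (use assms in \<open>auto simp: coeff_eq_0\<close>)
  finally show ?thesis .
qed

lemma skew_add_left: "(p + q) \<cdot> r = p \<cdot> r + q \<cdot> r"
proof -
  define N where "N = max (degree p) (degree q)"
  have "degree p \<le> N" "degree q \<le> N" "degree (p + q) \<le> N"
    by (auto simp: N_def intro: degree_add_le)
  then show ?thesis
    by (simp add: skew_mult_bounded[of _ N r "degree r"] distrib_right add_monom[symmetric]
        sum.distrib)
qed

lemma skew_add_right: "p \<cdot> (q + r) = p \<cdot> q + p \<cdot> r"
proof -
  interpret pow: field_endo "\<sigma> ^^ i" for i by (rule funpow_field_endo)
  define N where "N = max (degree q) (degree r)"
  have "degree q \<le> N" "degree r \<le> N" "degree (q + r) \<le> N"
    by (auto simp: N_def intro: degree_add_le)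
  then show ?thesis
    by (simp add: skew_mult_bounded[of p "degree p" _ N] distrib_left pow.endo_add
        add_monom[symmetric] sum.distrib)
qed

lemma skew_smult_left: "smult a p \<cdot> q = smult a (p \<cdot> q)"
  by (simp add: skew_mult_bounded[of "smult a p" "degree p" q "degree q"] degree_smult_le
      skew_mult_bounded[of p "degree p" q "degree q"] smult_sum_right smult_monom mult.assoc)

lemma skew_zero [simp]: "0 \<cdot> p = 0" "p \<cdot> 0 = 0"
  by (metis add.right_neutral add_left_cancel skew_add_left,
      metis add.right_neutral add_left_cancel skew_add_right)

lemma skew_uminus: "(- p) \<cdot> q = - (p \<cdot> q)" "p \<cdot> (- q) = - (p \<cdot> q)"
  using skew_add_left[of p "- p" q] skew_add_right[of p q "- q"]
  by (simp_all add: eq_neg_iff_add_eq_0 add.commute)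

lemma skew_diff: "(p - q) \<cdot> r = p \<cdot> r - q \<cdot> r" "r \<cdot> (p - q) = r \<cdot> p - r \<cdot> q"
  using skew_add_left[of p "- q" r] skew_add_right[of r p "- q"] by (simp_all add: skew_uminus)

section \<open>Left multiplication by x, associativity and degrees\<close>

definition xtimes :: "'a poly \<Rightarrow> 'a poly"
  where "xtimes p = pCons 0 (map_poly \<sigma> p)"

lemma coeff_xtimes: "coeff (xtimes p) i = (case i of 0 \<Rightarrow> 0 | Suc j \<Rightarrow> \<sigma> (coeff p j))"
  by (simp add: xtimes_def coeff_pCons coeff_map_poly split: nat.split)

lemma xtimes_add: "xtimes (p + q) = xtimes p + xtimes q"
  by (rule poly_eqI) (simp add: coeff_xtimes endo_add split: nat.split)

lemma xtimes_smult: "xtimes (smult a p) = smult (\<sigma> a) (xtimes p)"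
  by (rule poly_eqI) (simp add: coeff_xtimes endo_mult split: nat.split)

lemma xtimes_eq_0_iff: "xtimes p = 0 \<longleftrightarrow> p = 0"
  by (simp add: xtimes_def map_poly_eq_0_iff)

text \<open>A Horner step: \<open>pCons a p\<close> is a + p x, since x standing on the right of p
  causes no twist. This recursion replaces the double sum in the later inductions on the left
  factor.\<close>

lemma skew_pCons_left: "pCons a p \<cdot> q = smult a q + p \<cdot> xtimes q"
proof -
  interpret pow: field_endo "\<sigma> ^^ i" for i by (rule funpow_field_endo)
  have deg: "degree (xtimes q) \<le> Suc (degree q)"
    by (rule degree_le) (auto simp: coeff_xtimes coeff_eq_0 split: nat.split)
  have "pCons a p \<cdot> q = (\<Sum>i\<le>Suc (degree p). \<Sum>j\<le>degree q.
      monom (coeff (pCons a p) i * (\<sigma> ^^ i) (coeff q j)) (i + j))"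
    by (rule skew_mult_bounded) (auto simp: degree_pCons_le)
  also have "\<dots> = (\<Sum>j\<le>degree q. smult a (monom (coeff q j) j)) +
      (\<Sum>i\<le>degree p. \<Sum>j\<le>degree q. monom (coeff p i * (\<sigma> ^^ Suc i) (coeff q j)) (Suc i + j))"
    by (subst sum.atMost_Suc_shift) (simp add: smult_monom)
  also have "(\<Sum>j\<le>degree q. smult a (monom (coeff q j) j)) = smult a q"
    by (simp add: poly_as_sum_of_monoms flip: smult_sum_right)
  also have "(\<Sum>i\<le>degree p. \<Sum>j\<le>degree q.
      monom (coeff p i * (\<sigma> ^^ Suc i) (coeff q j)) (Suc i + j)) = p \<cdot> xtimes q"
    by (subst skew_mult_bounded[of p "degree p" "xtimes q" "Suc (degree q)"], simp, rule deg)
      (subst sum.atMost_Suc_shift, simp add: coeff_xtimes funpow_Suc_right del: funpow.simps)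
  finally show ?thesis .
qed

lemma skew_const_left: "[:a:] \<cdot> q = smult a q"
  by (simp add: skew_pCons_left)

lemma skew_X_left: "[:0, 1:] \<cdot> q = xtimes q"
  by (simp add: skew_pCons_left)

lemma skew_one [simp]: "1 \<cdot> q = q" "q \<cdot> 1 = q"
proof -
  show "1 \<cdot> q = q"
    using skew_const_left[of 1 q] by (simp add: one_pCons)
  interpret pow: field_endo "\<sigma> ^^ i" for i by (rule funpow_field_endo)
  show "q \<cdot> 1 = q"
    by (simp add: skew_mult_def poly_as_sum_of_monoms)
qed

text \<open>This is x p = p' x, where p' arises from p by applying \<sigma> to the
  coefficients.\<close>

lemma xtimes_skew: "xtimes (p \<cdot> q) = map_poly \<sigma> p \<cdot> xtimes q"
proof (induction p arbitrary: q)
  case (pCons a p)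
  have "map_poly \<sigma> (pCons a p) = pCons (\<sigma> a) (map_poly \<sigma> p)"
    by (simp add: map_poly_pCons)
  then show ?case
    by (simp add: skew_pCons_left xtimes_add xtimes_smult pCons)
qed (simp add: xtimes_def)

lemma skew_assoc: "(p \<cdot> q) \<cdot> r = p \<cdot> (q \<cdot> r)"
proof (induction p arbitrary: q)
  case (pCons a p)
  \<comment> \<open>Associativity with x as the left factor; the Horner recursion reduces the
    inductive step to it.\<close>
  have "xtimes q \<cdot> r = xtimes (q \<cdot> r)"
    by (simp add: xtimes_skew) (simp add: xtimes_def skew_pCons_left)
  then show ?case
    by (simp add: skew_pCons_left skew_add_left skew_smult_left pCons)
qed simp

lemma
  assumes "p \<noteq> 0" "q \<noteq> 0"
  shows degree_skew: "degree (p \<cdot> q) = degree p + degree q"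
    and lead_coeff_skew: "lead_coeff (p \<cdot> q) = lead_coeff p * (\<sigma> ^^ degree p) (lead_coeff q)"
    and skew_nonzero: "p \<cdot> q \<noteq> 0"
proof -
  interpret pow: field_endo "\<sigma> ^^ i" for i by (rule funpow_field_endo)
  have le: "degree (p \<cdot> q) \<le> degree p + degree q"
    unfolding skew_mult_def
    by (intro degree_sum_le finite_atMost order.trans[OF degree_monom_le]) auto
  \<comment> \<open>In total degree deg p + deg q only the two leading terms meet.\<close>
  have "coeff (p \<cdot> q) (degree p + degree q) = (\<Sum>i\<le>degree p. \<Sum>j\<le>degree q.
      if i = degree p \<and> j = degree q then coeff p i * (\<sigma> ^^ i) (coeff q j) else 0)"
    unfolding skew_mult_def coeff_sum coeff_monom
    by (intro sum.cong refl) auto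
  also have "\<dots> = (\<Sum>i\<le>degree p. if i = degree p then coeff p i * (\<sigma> ^^ i) (lead_coeff q) else 0)"
    by (intro sum.cong refl) auto
  also have "\<dots> = lead_coeff p * (\<sigma> ^^ degree p) (lead_coeff q)"
    by simp
  finally have lc: "coeff (p \<cdot> q) (degree p + degree q) =
    lead_coeff p * (\<sigma> ^^ degree p) (lead_coeff q)" .
  then have "coeff (p \<cdot> q) (degree p + degree q) \<noteq> 0"
    using assms by simp
  then show "degree (p \<cdot> q) = degree p + degree q" "p \<cdot> q \<noteq> 0"
    using le by (auto intro: antisym le_degree)
  then show "lead_coeff (p \<cdot> q) = lead_coeff p * (\<sigma> ^^ degree p) (lead_coeff q)"
    using lc by simp
qed

lemma skew_eq_0_iff [simp]: "p \<cdot> q = 0 \<longleftrightarrow> p = 0 \<or> q = 0"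
  using skew_nonzero by auto

lemma skew_cancel_right: "p \<cdot> r = q \<cdot> r \<Longrightarrow> r \<noteq> 0 \<Longrightarrow> p = q"
  using skew_diff(1)[of p q r] by simp

lemma skew_cancel_left: "r \<cdot> p = r \<cdot> q \<Longrightarrow> r \<noteq> 0 \<Longrightarrow> p = q"
  using skew_diff(2)[of r p q] by simp

end

section \<open>Matrices of linear maps over a subfield\<close>

lemma subset_image_list:
  assumes "set ys \<subseteq> g ` A"
  shows "\<exists>xs. ys = map g xs \<and> set xs \<subseteq> A"
proof -
  have "ys \<in> map g ` lists A"
    unfolding lists_image[symmetric] using assms by (simp add: lists_eq_set)
  then show ?thesis by (auto simp: lists_eq_set)
qed

text \<open>Spans and dimensions in HOL-Algebra take their scalars from the ring itself. The map
  \<open>h\<close> places K inside S, so that one development serves the big field, with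
  \<open>h\<close> the identity, and the skew polynomial ring, with scalars embedded as constant
  polynomials.\<close>

locale scalar_space = vector_space sc
  for sc :: "'a::field \<Rightarrow> 'b::ab_group_add \<Rightarrow> 'b" (infixr "*s" 75) +
  fixes S :: "'b ring" and h :: "'a \<Rightarrow> 'b" and K :: "'a set"
  assumes ring: "ring S"
    and carrier [simp]: "carrier S = UNIV"
    and add [simp]: "a \<oplus>\<^bsub>S\<^esub> b = a + b"
    and zero [simp]: "\<zero>\<^bsub>S\<^esub> = 0"
    and action: "h k \<otimes>\<^bsub>S\<^esub> v = k *s v"
    and subfield_K: "subfield K type_ring"
    and subfield_image: "subfield (h ` K) S"
begin

lemma zero_in_K: "0 \<in> K" and one_in_K: "1 \<in> K"
  and add_in_K: "a \<in> K \<Longrightarrow> b \<in> K \<Longrightarrow> a + b \<in> K"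
  and mult_in_K: "a \<in> K \<Longrightarrow> b \<in> K \<Longrightarrow> a * b \<in> K"
  using subringE[OF subfieldE(1)[OF subfield_K]] by (auto simp: ring_of_type_algebra_def)

lemma sum_in_K: "(\<And>i. i \<in> A \<Longrightarrow> g i \<in> K) \<Longrightarrow> sum g A \<in> K"
  by (induction A rule: infinite_finite_induct) (auto simp: zero_in_K add_in_K)

lemma h_eq_0_iff: "h k = 0 \<longleftrightarrow> k = 0"
proof -
  interpret S: ring S by (rule ring)
  have "\<one>\<^bsub>S\<^esub> \<noteq> 0"
    using subfieldE(6)[OF subfield_image] by simp
  moreover have "h k = k *s \<one>\<^bsub>S\<^esub>"
    using action[of k "\<one>\<^bsub>S\<^esub>"] S.r_one[of "h k"] by simp
  ultimately show ?thesis by simp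
qed

definition lincomb :: "(nat \<Rightarrow> 'a) \<Rightarrow> 'b list \<Rightarrow> 'b"
  where "lincomb c bs = (\<Sum>i<length bs. c i *s bs ! i)"

lemma combine_eq_lincomb:
  "length cs = length bs \<Longrightarrow> ring.combine S (map h cs) bs = lincomb ((!) cs) bs"
proof (induction cs bs rule: list_induct2)
  interpret S: ring S by (rule ring)
  case Nil
  show ?case by (simp add: lincomb_def)
next
  interpret S: ring S by (rule ring)
  case (Cons k ks u us)
  then show ?case
    by (simp add: lincomb_def action sum.lessThan_Suc_shift del: sum.lessThan_Suc)
qed

lemma lincomb_cong: "(\<And>i. i < length bs \<Longrightarrow> c i = d i) \<Longrightarrow> lincomb c bs = lincomb d bs"
  by (simp add: lincomb_def)

lemma ex_K_list:
  assumes "\<forall>i<n. c i \<in> K"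
  shows "\<exists>cs. length cs = n \<and> set cs \<subseteq> K \<and> (\<forall>i<n. cs ! i = c i)"
  using assms by (intro exI[of _ "map c [0..<n]"]) auto

lemma Span_eq_lincomb:
  "ring.Span S (h ` K) bs = {lincomb c bs | c. \<forall>i<length bs. c i \<in> K}"
proof -
  interpret S: ring S by (rule ring)
  have "S.Span (h ` K) bs = {S.combine ks bs |ks. length ks = length bs \<and> set ks \<subseteq> h ` K}"
    by (rule S.Span_eq_combine_set_length_version[OF subfield_image]) simp
  also have "\<dots> = {S.combine (map h cs) bs |cs. length cs = length bs \<and> set cs \<subseteq> K}"
  proof safe
    fix ks assume "length ks = length bs" "set ks \<subseteq> h ` K"
    then show "\<exists>cs. S.combine ks bs = S.combine (map h cs) bs \<and>
        length cs = length bs \<and> set cs \<subseteq> K"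
      using subset_image_list[of ks h K] by (metis length_map)
  next
    fix cs assume "length cs = length bs" "set cs \<subseteq> K"
    then show "\<exists>ks. S.combine (map h cs) bs = S.combine ks bs \<and>
        length ks = length bs \<and> set ks \<subseteq> h ` K"
      by (intro exI[of _ "map h cs"]) auto
  qed
  also have "\<dots> = {lincomb c bs | c. \<forall>i<length bs. c i \<in> K}"
  proof safe
    fix cs assume "length cs = length bs" "set cs \<subseteq> K"
    then show "\<exists>c. S.combine (map h cs) bs = lincomb c bs \<and> (\<forall>i<length bs. c i \<in> K)"
      by (intro exI[of _ "(!) cs"]) (auto simp: combine_eq_lincomb)
  next
    fix c assume "\<forall>i<length bs. c i \<in> K"
    from ex_K_list[OF this] obtain cs where
      "length cs = length bs" "set cs \<subseteq> K" "\<forall>i<length bs. cs ! i = c i" by blast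
    then show "\<exists>cs. lincomb c bs = S.combine (map h cs) bs \<and> length cs = length bs \<and> set cs \<subseteq> K"
      by (intro exI[of _ cs]) (auto simp: combine_eq_lincomb intro: lincomb_cong)
  qed
  finally show ?thesis .
qed

lemma independent_iff_lincomb:
  "ring.independent S (h ` K) bs \<longleftrightarrow>
    (\<forall>c. (\<forall>i<length bs. c i \<in> K) \<and> lincomb c bs = 0 \<longrightarrow> (\<forall>i<length bs. c i = 0))"
proof -
  interpret S: ring S by (rule ring)
  show ?thesis
  proof safe
    fix c i
    assume ind: "S.independent (h ` K) bs" and c: "\<forall>i<length bs. c i \<in> K" "lincomb c bs = 0"
      and i: "i < length bs"
    from ex_K_list[OF c(1)] obtain cs where cs:
      "length cs = length bs" "set cs \<subseteq> K" "\<forall>i<length bs. cs ! i = c i" by blast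
    then have "S.combine (map h cs) bs = 0"
      using c(2) lincomb_cong[of bs c "(!) cs"] by (simp add: combine_eq_lincomb)
    then have "set (take (length bs) (map h cs)) \<subseteq> {0}"
      using S.independent_imp_trivial_combine[OF subfield_image ind, of "map h cs"] cs by auto
    then have "h (c i) = 0"
      using cs i by (auto simp: set_conv_nth)
    then show "c i = 0"
      by (simp add: h_eq_0_iff)
  next
    assume *: "\<forall>c. (\<forall>i<length bs. c i \<in> K) \<and> lincomb c bs = 0 \<longrightarrow> (\<forall>i<length bs. c i = 0)"
    show "S.independent (h ` K) bs"
    proof (rule ccontr)
      assume "\<not> S.independent (h ` K) bs"
      then obtain ks where ks: "length ks = length bs" "S.combine ks bs = 0" "set ks \<subseteq> h ` K"
          "set ks \<noteq> {0}"
        using S.dependent_imp_non_trivial_combine[OF subfield_image, of bs] by auto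
      obtain cs where cs: "ks = map h cs" "set cs \<subseteq> K"
        using subset_image_list[OF ks(3)] by blast
      have "\<forall>i<length bs. cs ! i \<in> K" "lincomb ((!) cs) bs = 0"
        using cs ks(1,2) combine_eq_lincomb[of cs bs] by auto
      then have "\<forall>i<length bs. cs ! i = 0"
        using * by blast
      then have zero: "set ks \<subseteq> {0}"
        using ks(1) cs by (auto simp: set_conv_nth h_eq_0_iff)
      \<comment> \<open>The condition \<open>set ks \<noteq> {0}\<close> also holds for the empty
        list, so an empty \<open>bs\<close> has to be excluded on its own.\<close>
      then have "ks = []"
        using ks(4) by (cases ks) auto
      then have "bs = []" using ks(1) by simp
      then show False
        using \<open>\<not> S.independent (h ` K) bs\<close> by simp
    qed
  qed
qed

section \<open>Bases, coordinates and linear maps over the subfield\<close>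

definition kbasis :: "'b set \<Rightarrow> 'b list \<Rightarrow> bool"
  where "kbasis V bs \<longleftrightarrow> ring.independent S (h ` K) bs \<and> ring.Span S (h ` K) bs = V"

definition klinear :: "('b \<Rightarrow> 'b) \<Rightarrow> bool"
  where "klinear T \<longleftrightarrow> (\<forall>u v. T (u + v) = T u + T v) \<and> (\<forall>k\<in>K. \<forall>u. T (k *s u) = k *s T u)"

lemma kbasis_iff:
  "kbasis V bs \<longleftrightarrow> (\<forall>c. (\<forall>i<length bs. c i \<in> K) \<and> lincomb c bs = 0 \<longrightarrow> (\<forall>i<length bs. c i = 0)) \<and>
    {lincomb c bs | c. \<forall>i<length bs. c i \<in> K} = V"
  by (simp add: kbasis_def independent_iff_lincomb Span_eq_lincomb)

lemma kbasis_coords: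
  assumes "kbasis V bs" "v \<in> V"
  obtains c where "\<forall>i<length bs. c i \<in> K" "v = lincomb c bs"
  using assms unfolding kbasis_iff by blast

lemma lincomb_in: "kbasis V bs \<Longrightarrow> \<forall>i<length bs. c i \<in> K \<Longrightarrow> lincomb c bs \<in> V"
  unfolding kbasis_iff by blast

lemma lincomb_diff: "lincomb c bs - lincomb d bs = lincomb (\<lambda>i. c i - d i) bs"
  by (simp add: lincomb_def sum_subtractf scale_left_diff_distrib)

lemma uminus_in_K: "a \<in> K \<Longrightarrow> - a \<in> K"
proof -
  interpret type_ring: ring "type_ring :: 'a ring" by (rule ring_from_type_algebra)
  assume a: "a \<in> K"
  have "\<ominus>\<^bsub>type_ring\<^esub> a = - a"
    by (rule type_ring.minus_equality) (auto simp: ring_of_type_algebra_def)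
  then show "- a \<in> K"
    using subringE(5)[OF subfieldE(1)[OF subfield_K] a] by simp
qed

lemma diff_in_K: "a \<in> K \<Longrightarrow> b \<in> K \<Longrightarrow> a - b \<in> K"
  using add_in_K[of a "- b"] uminus_in_K by simp

lemma lincomb_inject:
  assumes "kbasis V bs" "\<forall>i<length bs. c i \<in> K" "\<forall>i<length bs. d i \<in> K" "lincomb c bs = lincomb d bs"
    and "i < length bs"
  shows "c i = d i"
proof -
  have zero: "lincomb (\<lambda>i. c i - d i) bs = 0"
    using assms(4) by (simp flip: lincomb_diff)
  have "\<forall>i<length bs. c i - d i \<in> K"
    using assms(2,3) diff_in_K by auto
  then have "\<forall>i<length bs. c i - d i = 0"
    using assms(1)[unfolded kbasis_iff, THEN conjunct1, rule_format, of "\<lambda>i. c i - d i"] zero by blast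
  then show ?thesis
    using assms(5) by simp
qed

lemma nth_eq_lincomb: "i < length bs \<Longrightarrow> bs ! i = lincomb (\<lambda>j. if j = i then 1 else 0) bs"
  by (simp add: lincomb_def if_distrib[of "\<lambda>k. k *s _"] cong: if_cong)

lemma nth_in: "kbasis V bs \<Longrightarrow> i < length bs \<Longrightarrow> bs ! i \<in> V"
  using lincomb_in[of V bs "\<lambda>j. if j = i then 1 else 0"] nth_eq_lincomb[of i bs]
  by (simp add: zero_in_K one_in_K)

lemma klinear_zero: "klinear T \<Longrightarrow> T 0 = 0"
  unfolding klinear_def by (metis add.right_neutral add_left_cancel)

lemma klinear_sum: "klinear T \<Longrightarrow> T (sum g A) = (\<Sum>i\<in>A. T (g i))"
  by (induction A rule: infinite_finite_induct) (auto simp: klinear_zero klinear_def)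

lemma klinear_diff: "klinear T \<Longrightarrow> T (u - v) = T u - T v"
  unfolding klinear_def by (metis add_diff_cancel_right' diff_add_cancel)

lemma klinear_lincomb:
  assumes "klinear T" "\<forall>i<length bs. c i \<in> K"
  shows "T (lincomb c bs) = lincomb c (map T bs)"
  using assms(2) by (simp add: lincomb_def klinear_sum[OF assms(1)])
    (use assms(1) in \<open>auto simp: klinear_def intro!: sum.cong\<close>)

lemma kbasis_map:
  assumes "klinear T" "kbasis V bs" "\<And>v. v \<in> V \<Longrightarrow> T v = 0 \<Longrightarrow> v = 0"
  shows "kbasis (T ` V) (map T bs)"
  unfolding kbasis_iff
proof (intro conjI allI impI; (elim conjE)?)
  fix c i
  assume c: "\<forall>i<length (map T bs). c i \<in> K" "lincomb c (map T bs) = 0" and i: "i < length (map T bs)"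
  then have "lincomb c bs = 0"
    using assms klinear_lincomb[OF assms(1), of bs c] lincomb_in[OF assms(2), of c] by simp
  then show "c i = 0"
    using assms(2) c(1) i unfolding kbasis_iff by auto
next
  have "{lincomb c (map T bs) |c. \<forall>i<length (map T bs). c i \<in> K} =
      T ` {lincomb c bs |c. \<forall>i<length bs. c i \<in> K}"
    using klinear_lincomb[OF assms(1), of bs] by (auto simp: image_iff) metis
  then show "{lincomb c (map T bs) |c. \<forall>i<length (map T bs). c i \<in> K} = T ` V"
    using assms(2) unfolding kbasis_iff by simp
qed

lemma kbasis_dimension: "kbasis V bs \<Longrightarrow> ring.dimension S (length bs) (h ` K) V"
  unfolding kbasis_def using ring.dimensionI[OF ring subfield_image] by blast

lemma dimension_kbasis:
  "ring.dimension S n (h ` K) V \<Longrightarrow> \<exists>bs. kbasis V bs \<and> length bs = n"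
  unfolding kbasis_def using ring.exists_base[OF ring subfield_image] by blast

lemma kbasis_length_eq: "kbasis V bs \<Longrightarrow> kbasis V cs \<Longrightarrow> length bs = length cs"
  using ring.dimension_is_inj[OF ring subfield_image] kbasis_dimension by blast

text \<open>Finite dimension turns injectivity into surjectivity: the images of a basis are
  independent and as many as dim V. This is how the twisting map and the multiplications of the
  algebra become bijective.\<close>

lemma klinear_inj_surj:
  assumes "klinear T" "kbasis V bs" "\<And>v. v \<in> V \<Longrightarrow> T v = 0 \<Longrightarrow> v = 0" "\<And>v. v \<in> V \<Longrightarrow> T v \<in> V"
  shows "T ` V = V"
proof -
  have map: "kbasis (T ` V) (map T bs)"
    by (rule kbasis_map[OF assms(1-3)])
  then have "ring.independent S (h ` K) (map T bs)" "ring.Span S (h ` K) (map T bs) = T ` V"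
    by (auto simp: kbasis_def)
  moreover have "set (map T bs) \<subseteq> V"
    using assms(4) nth_in[OF assms(2)] by (auto simp: set_conv_nth)
  ultimately show ?thesis
    using ring.independent_length_eq_dimension[OF ring subfield_image kbasis_dimension[OF assms(2)],
        of "map T bs"] by simp
qed

text \<open>Determinants are taken over a type, so the matrices live over the whole big field and
  membership of the entries in K is a separate condition. It is this condition that makes
  coordinates unique.\<close>

definition represents :: "'b list \<Rightarrow> 'a mat \<Rightarrow> ('b \<Rightarrow> 'b) \<Rightarrow> bool"
  where "represents bs M T \<longleftrightarrow> M \<in> carrier_mat (length bs) (length bs) \<and>
    (\<forall>i<length bs. \<forall>j<length bs. M $$ (i, j) \<in> K) \<and>
    (\<forall>j<length bs. T (bs ! j) = lincomb (\<lambda>i. M $$ (i, j)) bs)"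

section \<open>Change of basis, conjugation and determinants\<close>

lemma base_change:
  assumes "kbasis V bs" "length cs = n" "set cs \<subseteq> V"
  obtains P where "P \<in> carrier_mat (length bs) n" "\<forall>i<length bs. \<forall>j<n. P $$ (i, j) \<in> K"
    "\<forall>j<n. cs ! j = lincomb (\<lambda>i. P $$ (i, j)) bs"
proof -
  have "\<exists>c. (\<forall>i<length bs. c i \<in> K) \<and> cs ! j = lincomb c bs" if "j < n" for j
    using that assms nth_mem[of j cs] kbasis_coords[OF assms(1), of "cs ! j"] by blast
  then obtain c where c: "\<And>j i. j < n \<Longrightarrow> i < length bs \<Longrightarrow> c j i \<in> K"
    "\<And>j. j < n \<Longrightarrow> cs ! j = lincomb (c j) bs"
    by metis
  show ?thesis
    by (rule that[of "mat (length bs) n (\<lambda>(i, j). c j i)"]) (auto simp: c intro: lincomb_cong)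
qed

lemma ex_represents:
  assumes "kbasis V bs" "\<And>v. v \<in> V \<Longrightarrow> T v \<in> V"
  obtains M where "represents bs M T"
proof -
  have "set (map T bs) \<subseteq> V"
    using assms(2) nth_in[OF assms(1)] by (auto simp: set_conv_nth)
  then obtain M where "M \<in> carrier_mat (length bs) (length bs)"
    "\<forall>i<length bs. \<forall>j<length bs. M $$ (i, j) \<in> K"
    "\<forall>j<length bs. map T bs ! j = lincomb (\<lambda>i. M $$ (i, j)) bs"
    using base_change[OF assms(1), of "map T bs" "length bs"] by (metis length_map)
  then show ?thesis
    by (intro that[of M]) (simp add: represents_def)
qed

lemma lincomb_lincomb:
  assumes "length cs = n" "\<forall>k<n. cs ! k = lincomb (\<lambda>i. P $$ (i, k)) bs"
    "P \<in> carrier_mat (length bs) n" "Q \<in> carrier_mat n m" "j < m"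
  shows "lincomb (\<lambda>k. Q $$ (k, j)) cs = lincomb (\<lambda>i. (P * Q) $$ (i, j)) bs"
proof -
  have "lincomb (\<lambda>k. Q $$ (k, j)) cs =
      (\<Sum>k<n. \<Sum>i<length bs. (P $$ (i, k) * Q $$ (k, j)) *s bs ! i)"
    unfolding lincomb_def[of _ cs] using assms(1,2)
    by (simp add: lincomb_def scale_sum_right mult.commute)
  also have "\<dots> = (\<Sum>i<length bs. (\<Sum>k<n. P $$ (i, k) * Q $$ (k, j)) *s bs ! i)"
    by (subst sum.swap) (simp add: scale_sum_left)
  also have "\<dots> = lincomb (\<lambda>i. (P * Q) $$ (i, j)) bs"
    unfolding lincomb_def using assms(3-5)
    by (intro sum.cong refl) (auto simp: scalar_prod_def atLeast0LessThan)
  finally show ?thesis .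
qed

lemma mult_entries_in_K:
  assumes "P \<in> carrier_mat l n" "Q \<in> carrier_mat n m"
    "\<forall>i<l. \<forall>j<n. P $$ (i, j) \<in> K" "\<forall>i<n. \<forall>j<m. Q $$ (i, j) \<in> K" "i < l" "j < m"
  shows "(P * Q) $$ (i, j) \<in> K"
  using assms by (auto simp: scalar_prod_def intro!: sum_in_K mult_in_K)

lemma represents_comp:
  assumes "klinear T" "represents bs M T" "represents bs M' T'"
  shows "represents bs (M * M') (T \<circ> T')"
proof -
  have "T (T' (bs ! j)) = lincomb (\<lambda>i. (M * M') $$ (i, j)) bs" if "j < length bs" for j
  proof -
    have "T (T' (bs ! j)) = T (lincomb (\<lambda>i. M' $$ (i, j)) bs)"
      using that assms(3) by (simp add: represents_def)
    also have "\<dots> = lincomb (\<lambda>i. M' $$ (i, j)) (map T bs)"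
      using that assms(3) by (intro klinear_lincomb assms(1)) (auto simp: represents_def)
    also have "\<dots> = lincomb (\<lambda>i. (M * M') $$ (i, j)) bs"
      using that assms(2,3) by (intro lincomb_lincomb) (auto simp: represents_def)
    finally show ?thesis .
  qed
  moreover have "\<forall>i<length bs. \<forall>j<length bs. (M * M') $$ (i, j) \<in> K"
    using assms(2,3) mult_entries_in_K[of M "length bs" "length bs" M' "length bs"]
    by (auto simp: represents_def)
  ultimately show ?thesis
    using assms(2,3) unfolding represents_def by auto
qed

lemma represents_unique:
  assumes "kbasis V bs" "represents bs M T" "represents bs M' T'" "\<And>v. v \<in> V \<Longrightarrow> T v = T' v"
  shows "M = M'"
proof (rule eq_matI)
  fix i j assume "i < dim_row M'" "j < dim_col M'"
  then have ij: "i < length bs" "j < length bs"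
    using assms(3) by (auto simp: represents_def)
  have "lincomb (\<lambda>i. M $$ (i, j)) bs = lincomb (\<lambda>i. M' $$ (i, j)) bs"
    using assms(2-4) ij nth_in[OF assms(1) ij(2)] by (auto simp: represents_def)
  then show "M $$ (i, j) = M' $$ (i, j)"
    using assms(2,3) ij by (intro lincomb_inject[OF assms(1), of "\<lambda>i. M $$ (i, j)" "\<lambda>i. M' $$ (i, j)"])
      (auto simp: represents_def)
qed (use assms(2,3) in \<open>auto simp: represents_def\<close>)

lemma represents_id: "represents bs (1\<^sub>m (length bs)) (\<lambda>v. v)"
proof -
  have "lincomb (\<lambda>i. 1\<^sub>m (length bs) $$ (i, j)) bs = bs ! j" if "j < length bs" for j
    using that nth_eq_lincomb[OF that] lincomb_cong[of bs "\<lambda>i. 1\<^sub>m (length bs) $$ (i, j)"] by simp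
  then show ?thesis
    by (simp add: represents_def zero_in_K one_in_K)
qed

lemma lincomb_one_mat:
  assumes "kbasis V bs" "P \<in> carrier_mat (length bs) (length bs)"
    "\<forall>i<length bs. \<forall>j<length bs. P $$ (i, j) \<in> K"
    "\<forall>j<length bs. bs ! j = lincomb (\<lambda>i. P $$ (i, j)) bs"
  shows "P = 1\<^sub>m (length bs)"
  using assms by (intro represents_unique[OF assms(1) _ represents_id]) (auto simp: represents_def)

lemma base_change_det_nonzero:
  assumes "kbasis V bs" "kbasis V cs" "P \<in> carrier_mat (length bs) (length bs)"
    "\<forall>i<length bs. \<forall>j<length bs. P $$ (i, j) \<in> K"
    "\<forall>j<length bs. cs ! j = lincomb (\<lambda>i. P $$ (i, j)) bs"
  shows "det P \<noteq> 0"
proof -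
  have len: "length cs = length bs"
    by (rule kbasis_length_eq[OF assms(2,1)])
  have "set bs \<subseteq> V"
    using nth_in[OF assms(1)] by (auto simp: set_conv_nth)
  then obtain Q where Q: "Q \<in> carrier_mat (length bs) (length bs)"
      "\<forall>i<length bs. \<forall>j<length bs. Q $$ (i, j) \<in> K"
      "\<forall>j<length bs. bs ! j = lincomb (\<lambda>i. Q $$ (i, j)) cs"
    using base_change[OF assms(2), of bs "length bs"] len by metis
  have "P * Q = 1\<^sub>m (length bs)"
    using assms Q len mult_entries_in_K[OF assms(3) Q(1)] lincomb_lincomb[OF len assms(5,3) Q(1)]
    by (intro lincomb_one_mat[OF assms(1)]) auto
  then have "det P * det Q = 1"
    using det_mult[OF assms(3) Q(1)] by simp
  then show ?thesis by auto
qed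

lemma represents_det_nonzero:
  assumes "klinear T" "kbasis V bs" "represents bs M T"
    "\<And>v. v \<in> V \<Longrightarrow> T v = 0 \<Longrightarrow> v = 0" "\<And>v. v \<in> V \<Longrightarrow> T v \<in> V"
  shows "det M \<noteq> 0"
proof -
  have "kbasis V (map T bs)"
    using kbasis_map[OF assms(1,2,4)] klinear_inj_surj[OF assms(1,2,4,5)] by simp
  from base_change_det_nonzero[OF assms(2) this] show ?thesis
    using assms(3) by (simp add: represents_def)
qed

text \<open>U carries T' to T on V. With P the matrix of U, both \<open>P * M'\<close> and
  \<open>M * P\<close> represent the same map on V, so they agree, and det P cancels because U is
  injective; no inverse of U is formed.\<close>

lemma det_conjugate:
  assumes "klinear T" "klinear U" "kbasis V bs" "represents bs M T" "represents bs M' T'"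
    "\<And>v. v \<in> V \<Longrightarrow> U v = 0 \<Longrightarrow> v = 0" "\<And>v. v \<in> V \<Longrightarrow> U v \<in> V"
    "\<And>v. v \<in> V \<Longrightarrow> U (T' v) = T (U v)"
  shows "det M = det M'"
proof -
  obtain P where P: "represents bs P U"
    using ex_represents[OF assms(3), of U] assms(7) by blast
  have "P * M' = M * P"
    by (rule represents_unique[OF assms(3) represents_comp[OF assms(2) P assms(5)]
          represents_comp[OF assms(1,4) P]]) (simp add: assms(8))
  moreover have "M \<in> carrier_mat (length bs) (length bs)" "M' \<in> carrier_mat (length bs) (length bs)"
      "P \<in> carrier_mat (length bs) (length bs)"
    using assms(4,5) P by (auto simp: represents_def)
  ultimately have "det P * det M' = det M * det P"
    by (metis det_mult)
  moreover have "det P \<noteq> 0"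
    by (rule represents_det_nonzero[OF assms(2,3) P assms(6,7)])
  ultimately show ?thesis by simp
qed

text \<open>This makes the definite description in \<open>field_norm\<close> meaningful.\<close>

lemma det_basis_independent:
  assumes "klinear T" "kbasis V bs" "kbasis V cs" "represents bs M T" "represents cs M' T"
  shows "det M = det M'"
proof -
  have len: "length cs = length bs"
    by (rule kbasis_length_eq[OF assms(3,2)])
  have M: "M \<in> carrier_mat (length bs) (length bs)" "M' \<in> carrier_mat (length bs) (length bs)"
    using assms(4,5) len by (auto simp: represents_def)
  have "set cs \<subseteq> V"
    using nth_in[OF assms(3)] by (auto simp: set_conv_nth)
  then obtain P where P: "P \<in> carrier_mat (length bs) (length bs)"
      "\<forall>i<length bs. \<forall>j<length bs. P $$ (i, j) \<in> K"
      "\<forall>j<length bs. cs ! j = lincomb (\<lambda>i. P $$ (i, j)) bs"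
    using base_change[OF assms(2) len] len by metis
  have "(P * M') $$ (i, j) = (M * P) $$ (i, j)" if "i < length bs" "j < length bs" for i j
  proof -
    have "lincomb (\<lambda>i. (P * M') $$ (i, j)) bs = lincomb (\<lambda>i. M' $$ (i, j)) cs"
      using lincomb_lincomb[OF len P(3,1) M(2) that(2)] by simp
    also have "\<dots> = T (cs ! j)"
      using that len assms(5) by (simp add: represents_def)
    also have "\<dots> = T (lincomb (\<lambda>i. P $$ (i, j)) bs)"
      using that P(3) by simp
    also have "\<dots> = lincomb (\<lambda>i. P $$ (i, j)) (map T bs)"
      using that P(2) by (intro klinear_lincomb[OF assms(1)]) auto
    also have "\<dots> = lincomb (\<lambda>i. (M * P) $$ (i, j)) bs"
      using assms(4) by (intro lincomb_lincomb[OF _ _ M(1) P(1) that(2)]) (auto simp: represents_def)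
    finally have *: "lincomb (\<lambda>i. (P * M') $$ (i, j)) bs = lincomb (\<lambda>i. (M * P) $$ (i, j)) bs" .
    have "\<forall>i<length bs. (P * M') $$ (i, j) \<in> K"
      using mult_entries_in_K[OF P(1) M(2) P(2)] assms(5) len that by (auto simp: represents_def)
    moreover have "\<forall>i<length bs. (M * P) $$ (i, j) \<in> K"
      using mult_entries_in_K[OF M(1) P(1) _ P(2)] assms(4) that by (auto simp: represents_def)
    ultimately show ?thesis
      by (rule lincomb_inject[OF assms(2) _ _ * that(1)])
  qed
  then have "P * M' = M * P"
    using M P(1) by (intro eq_matI) auto
  then have "det P * det M' = det M * det P"
    using M P(1) by (metis det_mult)
  moreover have "det P \<noteq> 0"
    by (rule base_change_det_nonzero[OF assms(2,3) P])
  ultimately show ?thesis by simp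
qed

end

section \<open>Division with remainder and left ideals\<close>

text \<open>Coefficientwise version of \<open>residue_polys\<close>: closure under sums and scalars
  needs no case distinction for the zero polynomial, whose degree is 0 by convention.\<close>

definition polys_below :: "nat \<Rightarrow> 'a::field poly set"
  where "polys_below d = {p. \<forall>i\<ge>d. coeff p i = 0}"

lemma polys_below_iff: "p \<in> polys_below d \<longleftrightarrow> p = 0 \<or> degree p < d"
proof
  assume "p \<in> polys_below d"
  then show "p = 0 \<or> degree p < d"
    using leading_coeff_0_iff[of p] by (auto simp: polys_below_def not_less)
qed (auto simp: polys_below_def coeff_eq_0)

lemma residue_polys_eq: "residue_polys f = polys_below (degree f)"
  by (auto simp: residue_polys_def polys_below_iff)

lemma polys_below_add: "p \<in> polys_below d \<Longrightarrow> q \<in> polys_below d \<Longrightarrow> p + q \<in> polys_below d"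
  and polys_below_diff: "p \<in> polys_below d \<Longrightarrow> q \<in> polys_below d \<Longrightarrow> p - q \<in> polys_below d"
  and polys_below_smult: "p \<in> polys_below d \<Longrightarrow> smult a p \<in> polys_below d"
  and polys_below_0: "0 \<in> polys_below d"
  by (auto simp: polys_below_def)

context field_endo
begin

text \<open>Scalars fixed by \<sigma> pass through any left factor; this later makes the product of
  the algebra linear in its second argument.\<close>

lemma skew_smult_fixed:
  assumes "\<sigma> a = a"
  shows "p \<cdot> smult a q = smult a (p \<cdot> q)"
proof (induction p arbitrary: q)
  case (pCons b p)
  then show ?case
    by (simp add: skew_pCons_left xtimes_smult assms smult_add_right mult.commute)
qed simp

section \<open>Left ideals R f and remainders modulo f\<close>

definition left_mults :: "'a poly \<Rightarrow> 'a poly set"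
  where "left_mults f = range (\<lambda>q. q \<cdot> f)"

lemma left_mults_add: "p \<in> left_mults f \<Longrightarrow> q \<in> left_mults f \<Longrightarrow> p + q \<in> left_mults f"
  by (auto simp: left_mults_def simp flip: skew_add_left)

lemma left_mults_diff: "p \<in> left_mults f \<Longrightarrow> q \<in> left_mults f \<Longrightarrow> p - q \<in> left_mults f"
  by (auto simp: left_mults_def simp flip: skew_diff)

lemma left_mults_mult: "p \<in> left_mults f \<Longrightarrow> q \<cdot> p \<in> left_mults f"
  by (auto simp: left_mults_def simp flip: skew_assoc)

lemma left_mults_smult: "p \<in> left_mults f \<Longrightarrow> smult a p \<in> left_mults f"
  using left_mults_mult[of p f "[:a:]"] by (simp add: skew_const_left)

lemma left_mults_zero: "0 \<in> left_mults f"
  unfolding left_mults_def by (rule range_eqI[of _ _ 0]) simp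

lemma left_mults_self: "f \<in> left_mults f"
  unfolding left_mults_def by (rule range_eqI[of _ _ 1]) simp

lemma left_mults_below:
  assumes "p \<in> left_mults f" "p \<in> polys_below (degree f)"
  shows "p = 0"
proof (rule ccontr)
  assume p: "p \<noteq> 0"
  from assms(1) obtain q where q: "p = q \<cdot> f" by (auto simp: left_mults_def)
  with p have "degree p = degree q + degree f"
    by (auto intro: degree_skew)
  then show False
    using assms(2) p by (simp add: polys_below_iff)
qed

lemma right_division:
  assumes "f \<noteq> 0"
  shows "\<exists>q r. g = q \<cdot> f + r \<and> r \<in> polys_below (degree f)"
proof (induction "degree g" arbitrary: g rule: less_induct)
  interpret pow: field_endo "\<sigma> ^^ i" for i by (rule funpow_field_endo)
  case less
  show ?case
  proof (cases "g \<in> polys_below (degree f)")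
    case True
    then show ?thesis
      by (intro exI[of _ 0] exI[of _ g]) simp
  next
    case False
    then have g: "g \<noteq> 0" "degree f \<le> degree g"
      by (auto simp: polys_below_iff)
    define e where "e = degree g - degree f"
    \<comment> \<open>x^e f has leading coefficient \<sigma>^e applied to that of f, so with this c
      the product \<open>monom c e \<cdot> f\<close> cancels the leading term of g.\<close>
    define c where "c = lead_coeff g / (\<sigma> ^^ e) (lead_coeff f)"
    define h where "h = g - monom c e \<cdot> f"
    have c: "c \<noteq> 0"
      using g assms by (simp add: c_def)
    have deg: "degree (monom c e \<cdot> f) = degree g"
      using g c assms by (simp add: degree_skew monom_eq_0_iff degree_monom_eq e_def)
    have "lead_coeff (monom c e \<cdot> f) = lead_coeff g"
      using c assms by (subst lead_coeff_skew) (auto simp: monom_eq_0_iff degree_monom_eq c_def)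
    then have "coeff h (degree g) = 0"
      by (simp add: h_def deg)
    moreover have "degree h \<le> degree g"
      unfolding h_def by (intro degree_diff_le) (auto simp: deg)
    ultimately have "h = 0 \<or> degree h < degree g"
      by (metis le_neq_implies_less leading_coeff_0_iff)
    then have "\<exists>q r. h = q \<cdot> f + r \<and> r \<in> polys_below (degree f)"
    proof
      assume "h = 0"
      then show ?thesis
        by (intro exI[of _ 0]) (simp add: polys_below_0)
    qed (rule less)
    then obtain q r where "h = q \<cdot> f + r" "r \<in> polys_below (degree f)" by blast
    then show ?thesis
      by (intro exI[of _ "monom c e + q"] exI[of _ r]) (simp add: h_def skew_add_left algebra_simps)
  qed
qed

text \<open>Two remainders differ by a left multiple of f of degree below deg f, that is by 0; this
  justifies the definite description in \<open>skew_rem\<close>.\<close>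

lemma skew_rem_unique:
  assumes "r \<in> polys_below (degree f)" "g - r \<in> left_mults f"
  shows "skew_rem \<sigma> g f = r"
  unfolding skew_rem_def residue_polys_eq
proof (rule the_equality)
  from assms(2) obtain q where "g - r = q \<cdot> f" by (auto simp: left_mults_def)
  then show "r \<in> polys_below (degree f) \<and> (\<exists>q. g = q \<cdot> f + r)"
    using assms(1) by (auto intro!: exI[of _ q] simp: algebra_simps)
next
  fix s assume s: "s \<in> polys_below (degree f) \<and> (\<exists>q. g = q \<cdot> f + s)"
  then have "g - s \<in> left_mults f"
    by (auto simp: left_mults_def)
  then have "(g - r) - (g - s) \<in> left_mults f"
    by (rule left_mults_diff[OF assms(2)])
  then have "s - r \<in> left_mults f" by simp
  moreover have "s - r \<in> polys_below (degree f)"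
    using s assms(1) by (intro polys_below_diff) auto
  ultimately show "s = r"
    using left_mults_below by fastforce
qed

lemma
  assumes "f \<noteq> 0"
  shows skew_rem_below: "skew_rem \<sigma> g f \<in> polys_below (degree f)"
    and skew_rem_cong_mod: "g - skew_rem \<sigma> g f \<in> left_mults f"
proof -
  obtain q r where "g = q \<cdot> f + r" "r \<in> polys_below (degree f)"
    using right_division[OF assms] by blast
  moreover from this have "g - r \<in> left_mults f"
    by (auto simp: left_mults_def)
  ultimately show "skew_rem \<sigma> g f \<in> polys_below (degree f)" "g - skew_rem \<sigma> g f \<in> left_mults f"
    using skew_rem_unique by simp_all
qed

lemma skew_rem_eq_iff:
  assumes "f \<noteq> 0"
  shows "skew_rem \<sigma> g f = skew_rem \<sigma> h f \<longleftrightarrow> g - h \<in> left_mults f"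
proof
  assume "skew_rem \<sigma> g f = skew_rem \<sigma> h f"
  then show "g - h \<in> left_mults f"
    using left_mults_diff[OF skew_rem_cong_mod[OF assms, of g] skew_rem_cong_mod[OF assms, of h]]
    by simp
next
  assume "g - h \<in> left_mults f"
  then have "g - skew_rem \<sigma> h f \<in> left_mults f"
    using left_mults_add[OF _ skew_rem_cong_mod[OF assms, of h], of "g - h"] by simp
  then show "skew_rem \<sigma> g f = skew_rem \<sigma> h f"
    by (intro skew_rem_unique skew_rem_below assms)
qed

lemma skew_rem_eq_0_iff: "f \<noteq> 0 \<Longrightarrow> skew_rem \<sigma> g f = 0 \<longleftrightarrow> g \<in> left_mults f"
  using skew_rem_eq_iff[of f g 0] skew_rem_unique[of 0 f 0]
  by (simp add: polys_below_0 left_mults_zero)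

lemma skew_rem_add: "f \<noteq> 0 \<Longrightarrow> skew_rem \<sigma> (g + h) f = skew_rem \<sigma> g f + skew_rem \<sigma> h f"
  using left_mults_add[OF skew_rem_cong_mod[of f g] skew_rem_cong_mod[of f h]]
  by (intro skew_rem_unique polys_below_add skew_rem_below) (simp_all add: algebra_simps)

lemma skew_rem_smult: "f \<noteq> 0 \<Longrightarrow> skew_rem \<sigma> (smult a g) f = smult a (skew_rem \<sigma> g f)"
  using left_mults_smult[OF skew_rem_cong_mod[of f g], of a]
  by (intro skew_rem_unique polys_below_smult skew_rem_below) (simp_all add: smult_diff_right)

text \<open>A nonzero element of least degree generates, since remainders stay in the ideal; scaling
  makes it monic.\<close>

lemma left_ideal_principal:
  assumes "\<And>p q. p \<in> I \<Longrightarrow> q \<in> I \<Longrightarrow> p - q \<in> I" "\<And>p q. p \<in> I \<Longrightarrow> q \<cdot> p \<in> I"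
    and "p \<in> I" "p \<noteq> 0"
  obtains g where "lead_coeff g = 1" "I = left_mults g"
proof -
  have "\<exists>g. (g \<in> I \<and> g \<noteq> 0) \<and> (\<forall>h. h \<in> I \<and> h \<noteq> 0 \<longrightarrow> degree g \<le> degree h)"
    using ex_has_least_nat[of "\<lambda>g. g \<in> I \<and> g \<noteq> 0" p degree] assms(3,4) by blast
  then obtain g where g: "g \<in> I" "g \<noteq> 0" "\<And>h. h \<in> I \<Longrightarrow> h \<noteq> 0 \<Longrightarrow> degree g \<le> degree h"
    by blast
  define m where "m = smult (inverse (lead_coeff g)) g"
  have lc: "lead_coeff m = 1" and deg: "degree m = degree g" and m0: "m \<noteq> 0"
    using g(2) by (auto simp: m_def)
  have m: "m \<in> I"
    using assms(2)[OF g(1), of "[:inverse (lead_coeff g):]"] by (simp add: m_def skew_const_left)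
  have "I = left_mults m"
  proof
    show "left_mults m \<subseteq> I"
      using assms(2)[OF m] by (auto simp: left_mults_def)
    show "I \<subseteq> left_mults m"
    proof
      fix h assume h: "h \<in> I"
      obtain q r where qr: "h = q \<cdot> m + r" "r \<in> polys_below (degree m)"
        using right_division[OF m0] by blast
      then have "r \<in> I"
        using assms(1)[OF h assms(2)[OF m, of q]] by simp
      then have "r = 0"
        using g(3)[of r] qr(2) deg by (cases "r = 0") (auto simp: polys_below_iff)
      then show "h \<in> left_mults m"
        using qr(1) by (auto simp: left_mults_def)
    qed
  qed
  then show ?thesis
    using that lc by blast
qed

section \<open>Irreducibility, annihilators and the bound\<close>

definition skew_irreducible :: "'a poly \<Rightarrow> bool"
  where "skew_irreducible p \<longleftrightarrow> 0 < degree p \<and> (\<forall>u v. p = u \<cdot> v \<longrightarrow> degree u = 0 \<or> degree v = 0)"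

text \<open>Irreducibility makes R f a maximal left ideal, so R/Rf is simple and generated by the
  nonzero class of b; u is a left inverse of b modulo R f.\<close>

lemma skew_irreducible_maximal:
  assumes "skew_irreducible f" "b \<notin> left_mults f"
  obtains u v where "u \<cdot> b + v \<cdot> f = 1"
proof -
  define I where "I = {u \<cdot> b + v \<cdot> f | u v. True}"
  have "p - q \<in> I" if "p \<in> I" "q \<in> I" for p q
  proof -
    from that obtain u v u' v' where "p = u \<cdot> b + v \<cdot> f" "q = u' \<cdot> b + v' \<cdot> f"
      by (auto simp: I_def)
    then have "p - q = (u - u') \<cdot> b + (v - v') \<cdot> f"
      by (simp add: skew_diff)
    then show ?thesis unfolding I_def by blast
  qed
  moreover have "q \<cdot> p \<in> I" if "p \<in> I" for p q
  proof -
    from that obtain u v where "p = u \<cdot> b + v \<cdot> f"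
      by (auto simp: I_def)
    then have "q \<cdot> p = (q \<cdot> u) \<cdot> b + (q \<cdot> v) \<cdot> f"
      by (simp add: skew_add_right skew_assoc)
    then show ?thesis unfolding I_def by blast
  qed
  moreover have b: "b \<in> I"
    unfolding I_def by (rule CollectI, rule exI[of _ 1], rule exI[of _ 0]) simp
  moreover have f: "f \<in> I"
    unfolding I_def by (rule CollectI, rule exI[of _ 0], rule exI[of _ 1]) simp
  moreover have "f \<noteq> 0"
    using assms(1) by (auto simp: skew_irreducible_def)
  ultimately obtain g where g: "lead_coeff g = 1" "I = left_mults g"
    using left_ideal_principal[of I f] by metis
  from f g(2) obtain q where q: "f = q \<cdot> g" by (auto simp: left_mults_def)
  \<comment> \<open>Otherwise the cofactor of g in f is constant, g is a scalar multiple of f, and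
    b, being a left multiple of g, would lie in R f.\<close>
  have "degree g = 0"
  proof (rule ccontr)
    assume "degree g \<noteq> 0"
    then have "degree q = 0"
      using assms(1) q unfolding skew_irreducible_def by metis
    then obtain a where a: "q = [:a:]" by (rule degree_eq_zeroE)
    with q \<open>f \<noteq> 0\<close> have "a \<noteq> 0" by auto
    then have "g = smult (inverse a) f"
      by (simp add: q a skew_const_left)
    then have "g \<in> left_mults f"
      by (simp add: left_mults_smult left_mults_self)
    moreover from b g(2) obtain r where "b = r \<cdot> g" by (auto simp: left_mults_def)
    ultimately show False
      using assms(2) left_mults_mult by blast
  qed
  then have "g = 1"
    using g(1) by (auto elim!: degree_eq_zeroE simp: one_pCons)
  then have "1 \<in> I"
    using g(2) left_mults_self by blast
  then obtain u v where "u \<cdot> b + v \<cdot> f = 1" by (auto simp: I_def)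
  then show ?thesis by (rule that)
qed

text \<open>The annihilator in R of the class of b in the left module R/Rf.\<close>

definition ann :: "'a poly \<Rightarrow> 'a poly \<Rightarrow> 'a poly set"
  where "ann f b = {g. g \<cdot> b \<in> left_mults f}"

lemma ann_principal:
  assumes "B \<in> ann f b" "B \<noteq> 0"
  obtains g where "lead_coeff g = 1" "ann f b = left_mults g"
proof (rule left_ideal_principal[of "ann f b" B])
  show "p - q \<in> ann f b" if "p \<in> ann f b" "q \<in> ann f b" for p q
    using that by (simp add: ann_def skew_diff left_mults_diff)
  show "q \<cdot> p \<in> ann f b" if "p \<in> ann f b" for p q
    using that by (simp add: ann_def skew_assoc left_mults_mult)
qed (use assms that in auto)

lemma skew_ring: "ring (skew_poly_ring \<sigma>)"
proof (rule ringI)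
  show "abelian_group (skew_poly_ring \<sigma>)"
  proof (rule abelian_groupI)
    fix p assume "p \<in> carrier (skew_poly_ring \<sigma>)"
    then show "\<exists>q\<in>carrier (skew_poly_ring \<sigma>). q \<oplus>\<^bsub>skew_poly_ring \<sigma>\<^esub> p = \<zero>\<^bsub>skew_poly_ring \<sigma>\<^esub>"
      by (intro bexI[of _ "- p"]) (auto simp: skew_poly_ring_def)
  qed (auto simp: skew_poly_ring_def)
  show "Group.monoid (skew_poly_ring \<sigma>)"
    by (rule Group.monoidI) (auto simp: skew_poly_ring_def skew_assoc)
qed (auto simp: skew_poly_ring_def skew_add_left skew_add_right)

lemma skew_Units_iff: "p \<in> Units (skew_poly_ring \<sigma>) \<longleftrightarrow> p \<noteq> 0 \<and> degree p = 0"
proof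
  assume "p \<in> Units (skew_poly_ring \<sigma>)"
  then obtain q where q: "q \<cdot> p = 1"
    by (auto simp: Units_def skew_poly_ring_def)
  then have "p \<noteq> 0" "q \<noteq> 0" by auto
  then show "p \<noteq> 0 \<and> degree p = 0"
    using q degree_skew[of q p] by auto
next
  assume "p \<noteq> 0 \<and> degree p = 0"
  then obtain a where a: "p = [:a:]" "a \<noteq> 0" by (auto elim!: degree_eq_zeroE)
  then show "p \<in> Units (skew_poly_ring \<sigma>)"
    unfolding Units_def
    by (auto simp: skew_poly_ring_def skew_const_left one_pCons intro!: exI[of _ "[:inverse a:]"])
qed

text \<open>HOL-Algebra speaks of proper left factors only. If p = u v and u is not a proper factor,
  then u = p e, and cancelling u in u = u v e gives v e = 1, so that v is constant.\<close>

lemma irreducible_skew_iff: "Divisibility.irreducible (skew_poly_ring \<sigma>) p \<longleftrightarrow> skew_irreducible p"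
proof
  assume irr: "Divisibility.irreducible (skew_poly_ring \<sigma>) p"
  have proper: "b \<noteq> 0 \<and> degree b = 0" if "p = b \<cdot> c" "\<And>e. b \<noteq> p \<cdot> e" for b c
  proof -
    have "properfactor (skew_poly_ring \<sigma>) b p"
      using that unfolding properfactor_def factor_def by (auto simp: skew_poly_ring_def)
    moreover have "b \<in> carrier (skew_poly_ring \<sigma>)"
      by (simp add: skew_poly_ring_def)
    ultimately have "b \<in> Units (skew_poly_ring \<sigma>)"
      using irr unfolding Divisibility.irreducible_def by blast
    then show ?thesis using skew_Units_iff by blast
  qed
  \<comment> \<open>For p = 0 the polynomial x would be a proper factor, hence a unit.\<close>
  have p0: "p \<noteq> 0"
  proof
    assume "p = 0"
    then show False
      using proper[of "[:0, 1:]" 0] by simp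
  qed
  moreover have "p \<notin> Units (skew_poly_ring \<sigma>)"
    using irr by (simp add: Divisibility.irreducible_def)
  moreover have "degree u = 0 \<or> degree v = 0" if p: "p = u \<cdot> v" for u v
  proof (cases "\<exists>e. u = p \<cdot> e")
    case True
    then obtain e where "u \<cdot> 1 = u \<cdot> (v \<cdot> e)"
      using p by (auto simp: skew_assoc)
    then have "v \<cdot> e = 1"
      using p p0 skew_cancel_left[of u 1 "v \<cdot> e"] by auto
    moreover from this have "v \<noteq> 0" "e \<noteq> 0" by auto
    ultimately show ?thesis
      using degree_skew[of v e] by simp
  qed (use proper p in blast)
  ultimately show "skew_irreducible p"
    unfolding skew_irreducible_def skew_Units_iff neq0_conv[symmetric] by metis
next
  assume irr: "skew_irreducible p"
  then have p0: "p \<noteq> 0" by (auto simp: skew_irreducible_def)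
  have "b \<noteq> 0 \<and> degree b = 0" if p: "p = b \<cdot> c" and b: "\<And>e. b \<noteq> p \<cdot> e" for b c
  proof -
    have "degree c \<noteq> 0"
    proof
      assume "degree c = 0"
      then obtain a where a: "c = [:a:]" by (rule degree_eq_zeroE)
      then have "b = p \<cdot> [:inverse a:]"
        using p p0 by (auto simp: skew_assoc skew_const_left simp flip: one_pCons)
      then show False using b by blast
    qed
    then show ?thesis
      using irr p p0 unfolding skew_irreducible_def by (metis skew_zero(1))
  qed
  moreover have "p \<notin> Units (skew_poly_ring \<sigma>)"
    using irr by (simp add: skew_Units_iff skew_irreducible_def)
  ultimately show "Divisibility.irreducible (skew_poly_ring \<sigma>) p"
    unfolding Divisibility.irreducible_def properfactor_def factor_def skew_Units_iff
    by (auto simp: skew_poly_ring_def)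
qed

definition skew_central :: "'a poly \<Rightarrow> bool"
  where "skew_central B \<longleftrightarrow> (\<forall>g. B \<cdot> g = g \<cdot> B)"

text \<open>A central element of R f annihilates all of R/Rf, as B b = b B.\<close>

lemma central_left_mults: "skew_central B \<Longrightarrow> B \<in> left_mults f \<Longrightarrow> B \<cdot> b \<in> left_mults f"
  by (simp add: skew_central_def left_mults_mult)

lemma PIdl_skew: "PIdl\<^bsub>skew_poly_ring \<sigma>\<^esub> f = left_mults f"
  by (auto simp: cgenideal_def left_mults_def skew_poly_ring_def)

text \<open>The last fact says that the annihilator of R/Rf lies in R B. That annihilator is a
  two-sided ideal, contained in R f as b = 1 shows, so it lies in the ideal generated by B, and this
  ideal stays inside R B because B is central.\<close>

lemma is_boundD:
  assumes "is_bound \<sigma> f B"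
  shows "lead_coeff B = 1" "skew_central B" "B \<in> left_mults f"
    "\<And>g. (\<And>b. g \<cdot> b \<in> left_mults f) \<Longrightarrow> g \<in> left_mults B"
proof -
  interpret R: ring "skew_poly_ring \<sigma>" by (rule skew_ring)
  note bound = assms[unfolded is_bound_def Let_def PIdl_skew]
  show "lead_coeff B = 1" using bound by simp
  show central: "skew_central B"
    using bound by (auto simp: skew_central_def ring_center_def skew_poly_ring_def)
  show "B \<in> left_mults f"
    using bound R.genideal_self'[of B] by (auto simp: skew_poly_ring_def)
  have idealI: "ideal I (skew_poly_ring \<sigma>)"
    if "\<And>p q. p \<in> I \<Longrightarrow> q \<in> I \<Longrightarrow> p - q \<in> I" "\<And>p q. p \<in> I \<Longrightarrow> q \<cdot> p \<in> I"
      "\<And>p q. p \<in> I \<Longrightarrow> p \<cdot> q \<in> I" "0 \<in> I" for I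
  proof (rule Ideal.idealI)
    show "subgroup I (add_monoid (skew_poly_ring \<sigma>))"
    proof
      fix p q assume *: "p \<in> I" "q \<in> I"
      then have "p - (0 - q) \<in> I" using that by blast
      then show "p \<otimes>\<^bsub>add_monoid (skew_poly_ring \<sigma>)\<^esub> q \<in> I"
        by (simp add: skew_poly_ring_def)
      have "\<ominus>\<^bsub>skew_poly_ring \<sigma>\<^esub> p = - p"
        by (rule R.minus_equality) (auto simp: skew_poly_ring_def)
      then show "inv\<^bsub>add_monoid (skew_poly_ring \<sigma>)\<^esub> p \<in> I"
        using that(1)[OF that(4) *(1)] by (simp add: a_inv_def)
    qed (auto simp: skew_poly_ring_def that)
  qed (use that in \<open>auto simp: skew_poly_ring_def intro: skew_ring[unfolded skew_poly_ring_def]\<close>)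
  have Idl: "Idl\<^bsub>skew_poly_ring \<sigma>\<^esub> {B} \<subseteq> left_mults B"
  proof (rule R.genideal_minimal)
    show "ideal (left_mults B) (skew_poly_ring \<sigma>)"
    proof (rule idealI)
      fix p q assume "p \<in> left_mults B"
      then obtain u where "p = u \<cdot> B" by (auto simp: left_mults_def)
      then have "p \<cdot> q = (u \<cdot> q) \<cdot> B"
        using central by (simp add: skew_assoc skew_central_def)
      then show "p \<cdot> q \<in> left_mults B" by (auto simp: left_mults_def)
    qed (auto intro: left_mults_diff left_mults_mult left_mults_zero)
  qed (auto simp: left_mults_self)
  define I where "I = {g. \<forall>b. g \<cdot> b \<in> left_mults f}"
  have "ideal I (skew_poly_ring \<sigma>)"
    by (rule idealI)
      (auto simp: I_def skew_diff skew_assoc intro: left_mults_diff left_mults_mult left_mults_zero)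
  moreover have "I \<subseteq> left_mults f"
    unfolding I_def by (metis (mono_tags, lifting) mem_Collect_eq skew_one(2) subsetI)
  ultimately have "I \<subseteq> left_mults B"
    using bound Idl by blast
  then show "g \<in> left_mults B" if "\<And>b. g \<cdot> b \<in> left_mults f" for g
    using that by (auto simp: I_def)
qed

end

section \<open>Simple modules and conjugate companion maps\<close>

context scalar_space
begin

lemma lincomb_append:
  "lincomb c (xs @ ys) = lincomb c xs + lincomb (\<lambda>i. c (i + length xs)) ys"
proof -
  have "lincomb c (xs @ ys) = (\<Sum>i\<in>{..<length xs}. c i *s (xs @ ys) ! i) +
      (\<Sum>i\<in>{length xs..<length xs + length ys}. c i *s (xs @ ys) ! i)"
    unfolding lincomb_def
    by (subst sum.union_disjoint[symmetric]) (auto intro!: sum.cong)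
  also have "(\<Sum>i\<in>{length xs..<length xs + length ys}. c i *s (xs @ ys) ! i) =
      (\<Sum>i<length ys. c (i + length xs) *s ys ! i)"
    using sum.shift_bounds_nat_ivl[of "\<lambda>i. c i *s (xs @ ys) ! i" 0 "length xs" "length ys"]
    by (simp add: atLeast0LessThan add.commute nth_append)
  finally show ?thesis
    by (simp add: lincomb_def nth_append)
qed

end

lemma ring_hom_const:
  assumes "field_endo \<sigma>"
  shows "ring_hom_ring type_ring (skew_poly_ring \<sigma>) (\<lambda>k. [:k:])"
proof -
  interpret field_endo \<sigma> by fact
  show ?thesis
    by (rule ring_hom_ringI[OF ring_from_type_algebra skew_ring])
      (auto simp: ring_of_type_algebra_def skew_poly_ring_def skew_const_left one_pCons)
qed

text \<open>K stands for the small field here: the final theorem instantiates it with K'. Since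
  \<sigma> fixes it pointwise, left multiplication by x is linear over it.\<close>

locale skew_over = field_endo \<sigma> for \<sigma> :: "'a::field \<Rightarrow> 'a" +
  fixes K :: "'a set"
  assumes subfield_base: "subfield K type_ring"
    and fixed: "k \<in> K \<Longrightarrow> \<sigma> k = k"
begin

sublocale L: scalar_space "(*)" "type_ring :: 'a ring" "\<lambda>k. k" K
proof (intro scalar_space.intro scalar_space_axioms.intro)
  show "Vector_Spaces.vector_space ((*) :: 'a \<Rightarrow> 'a \<Rightarrow> 'a)"
    by unfold_locales (auto simp: algebra_simps)
  show "Ring.ring (type_ring :: 'a ring)" by (rule ring_from_type_algebra)
  show "subfield ((\<lambda>k. k) ` K) type_ring" using subfield_base by simp
qed (auto simp: ring_of_type_algebra_def intro: subfield_base[unfolded ring_of_type_algebra_def])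

sublocale P: scalar_space smult "skew_poly_ring \<sigma>" "\<lambda>k. [:k:]" K
proof (intro scalar_space.intro scalar_space_axioms.intro)
  show "Vector_Spaces.vector_space (smult :: 'a \<Rightarrow> 'a poly \<Rightarrow> 'a poly)"
    by unfold_locales (auto simp: smult_add_left smult_add_right)
  show "Ring.ring (skew_poly_ring \<sigma>)" by (rule skew_ring)
  interpret hom: ring_hom_ring "type_ring :: 'a ring" "skew_poly_ring \<sigma>" "\<lambda>k. [:k:]"
    by (rule ring_hom_const) unfold_locales
  show "subfield ((\<lambda>k. [:k:]) ` K) (skew_poly_ring \<sigma>)"
    by (rule hom.img_is_subfield[OF subfield_base]) (simp add: skew_poly_ring_def)
qed (auto simp: skew_poly_ring_def skew_const_left intro: subfield_base)

lemma lincomb_const: "P.lincomb c (map (\<lambda>b. [:b:]) bs) = [:L.lincomb c bs:]"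
  unfolding P.lincomb_def L.lincomb_def
  by (rule poly_eqI) (auto simp: coeff_sum coeff_pCons split: nat.split)

lemma lincomb_pCons_0: "P.lincomb c (map (pCons 0) cs) = pCons 0 (P.lincomb c cs)"
  unfolding P.lincomb_def
  by (rule poly_eqI) (auto simp: coeff_sum coeff_pCons split: nat.split)

text \<open>The constant term is split off. Constants come first in the basis, so that a map which
  fixes all multiples of x has a block triangular matrix; \<open>det_replace_constant\<close> relies
  on this order.\<close>

lemma kbasis_polys_below_Suc:
  assumes "L.kbasis UNIV bs" "P.kbasis (polys_below d) cs"
  shows "P.kbasis (polys_below (Suc d)) (map (\<lambda>b. [:b:]) bs @ map (pCons 0) cs)"
proof -
  let ?b = "map (\<lambda>b. [:b:]) bs @ map (pCons 0) cs"
  have lincomb: "P.lincomb c ?b =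
      pCons (L.lincomb c bs) (P.lincomb (\<lambda>i. c (i + length bs)) cs)" for c
    by (simp add: P.lincomb_append lincomb_const lincomb_pCons_0)
  show ?thesis
    unfolding P.kbasis_iff
  proof (intro conjI allI impI; (elim conjE)?)
    fix c i
    assume c: "\<forall>i<length ?b. c i \<in> K" "P.lincomb c ?b = 0" and i: "i < length ?b"
    have "\<forall>i<length bs. c i = 0"
      using assms(1)[unfolded L.kbasis_iff, THEN conjunct1, rule_format, of c] c
      by (auto simp: lincomb)
    moreover have "\<forall>i<length cs. c (i + length bs) = 0"
      using assms(2)[unfolded P.kbasis_iff, THEN conjunct1, rule_format,
          of "\<lambda>i. c (i + length bs)"] c
      by (auto simp: lincomb)
    moreover have "i - length bs < length cs" if "\<not> i < length bs"
      using i that by auto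
    ultimately show "c i = 0"
      by (cases "i < length bs") (metis, metis le_add_diff_inverse2 not_less)
  next
    show "{P.lincomb c ?b |c. \<forall>i<length ?b. c i \<in> K} = polys_below (Suc d)"
    proof (intro equalityI subsetI)
      fix p assume "p \<in> {P.lincomb c ?b |c. \<forall>i<length ?b. c i \<in> K}"
      then obtain c where c: "\<forall>i<length ?b. c i \<in> K" "p = P.lincomb c ?b" by blast
      have "P.lincomb (\<lambda>i. c (i + length bs)) cs \<in> polys_below d"
        using c(1) by (intro P.lincomb_in[OF assms(2)]) auto
      then show "p \<in> polys_below (Suc d)"
        unfolding c(2) lincomb by (auto simp: polys_below_def coeff_pCons split: nat.split)
    next
      fix p :: "'a poly" assume p: "p \<in> polys_below (Suc d)"
      obtain a q where pq: "p = pCons a q" by (rule pCons_cases)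
      with p have "coeff q i = 0" if "i \<ge> d" for i
        using that by (auto simp: polys_below_def dest: spec[of _ "Suc i"])
      then have "q \<in> polys_below d" by (simp add: polys_below_def)
      then obtain y where y: "\<forall>i<length cs. y i \<in> K" "q = P.lincomb y cs"
        using P.kbasis_coords[OF assms(2)] by blast
      obtain x where x: "\<forall>i<length bs. x i \<in> K" "a = L.lincomb x bs"
        using L.kbasis_coords[OF assms(1), of a] by blast
      define c where "c i = (if i < length bs then x i else y (i - length bs))" for i
      have "p = P.lincomb c ?b"
        unfolding lincomb pq x(2) y(2)
        by (auto simp: c_def intro: L.lincomb_cong P.lincomb_cong)
      moreover have "\<forall>i<length ?b. c i \<in> K"
        using x(1) y(1) by (auto simp: c_def)
      ultimately show "p \<in> {P.lincomb c ?b |c. \<forall>i<length ?b. c i \<in> K}" by blast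
    qed
  qed
qed

lemma kbasis_polys_below:
  assumes "L.kbasis UNIV bs"
  shows "\<exists>cs. P.kbasis (polys_below d) cs \<and> length cs = d * length bs"
proof (induction d)
  case 0
  have "P.kbasis (polys_below 0) []"
    unfolding P.kbasis_iff by (auto simp: P.lincomb_def polys_below_def poly_eq_iff)
  then show ?case by (intro exI[of _ "[]"]) simp
next
  case (Suc d)
  then obtain cs where "P.kbasis (polys_below d) cs" "length cs = d * length bs" by blast
  with kbasis_polys_below_Suc[OF assms this(1)] show ?case
    by (intro exI[of _ "map (\<lambda>b. [:b:]) bs @ map (pCons 0) cs"]) simp
qed

lemma kbasis_UNIV_nonempty:
  assumes "L.kbasis UNIV bs"
  shows "length bs > 0"
proof -
  obtain c where "1 = L.lincomb c bs"
    using L.kbasis_coords[OF assms UNIV_I] by metis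
  then show ?thesis
    by (cases bs) (auto simp: L.lincomb_def)
qed

lemma klinear_right_mult_rem: "f \<noteq> 0 \<Longrightarrow> P.klinear (\<lambda>v. skew_rem \<sigma> (v \<cdot> b) f)"
  by (auto simp: P.klinear_def skew_add_left skew_smult_left skew_rem_add skew_rem_smult)

lemma klinear_xtimes_rem: "f \<noteq> 0 \<Longrightarrow> P.klinear (\<lambda>v. skew_rem \<sigma> (xtimes v) f)"
  by (auto simp: P.klinear_def xtimes_add xtimes_smult skew_rem_add skew_rem_smult fixed)

lemma right_mult_rem_inj:
  assumes "f \<noteq> 0" "ann f b = left_mults g" "v \<in> polys_below (degree g)" "skew_rem \<sigma> (v \<cdot> b) f = 0"
  shows "v = 0"
proof -
  have "v \<in> ann f b"
    using assms(1,4) by (simp add: skew_rem_eq_0_iff ann_def)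
  then show ?thesis
    using left_mults_below[of v g] assms(2,3) by simp
qed

text \<open>The map induced by v \<mapsto> v b is injective on R/Rg since R g is the annihilator,
  and surjective onto R/Rf since R/Rf is simple. Both sides have dimension degree times
  \<open>length bs\<close>, and \<open>length bs\<close> is positive.\<close>

lemma degree_ann_generator:
  assumes "L.kbasis UNIV bs" "skew_irreducible f" "b \<notin> left_mults f"
    and "lead_coeff g = 1" "ann f b = left_mults g"
  shows "degree g = degree f"
proof -
  have f0: "f \<noteq> 0" and g0: "g \<noteq> 0"
    using assms(2,4) by (auto simp: skew_irreducible_def)
  define \<phi> where "\<phi> v = skew_rem \<sigma> (v \<cdot> b) f" for v
  have "\<phi> ` polys_below (degree g) = polys_below (degree f)"
  proof (intro equalityI subsetI)
    fix v :: "'a poly" assume v: "v \<in> polys_below (degree f)"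
    \<comment> \<open>With s b + t f = 1 the element v s is a preimage of v, and reducing it modulo
      g does not change its image.\<close>
    obtain s t where "s \<cdot> b + t \<cdot> f = 1"
      using skew_irreducible_maximal[OF assms(2,3)] by blast
    then have "v = v \<cdot> (s \<cdot> b + t \<cdot> f)" by simp
    then have st: "v = (v \<cdot> s) \<cdot> b + (v \<cdot> t) \<cdot> f"
      by (simp only: skew_add_right skew_assoc)
    define r where "r = skew_rem \<sigma> (v \<cdot> s) g"
    have "v \<cdot> s - r \<in> ann f b"
      unfolding assms(5) r_def by (rule skew_rem_cong_mod[OF g0])
    then have "(v \<cdot> s) \<cdot> b - r \<cdot> b \<in> left_mults f"
      by (simp add: ann_def skew_diff)
    moreover have "(v \<cdot> t) \<cdot> f \<in> left_mults f"
      by (auto simp: left_mults_def)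
    moreover have "r \<cdot> b - v = - (v \<cdot> t) \<cdot> f - ((v \<cdot> s) \<cdot> b - r \<cdot> b)"
      by (subst st) (simp add: skew_uminus)
    ultimately have "r \<cdot> b - v \<in> left_mults f"
      using left_mults_diff left_mults_zero
      by (metis diff_0 skew_uminus(1))
    then have "\<phi> r = v"
      unfolding \<phi>_def by (rule skew_rem_unique[OF v])
    moreover have "r \<in> polys_below (degree g)"
      unfolding r_def by (rule skew_rem_below[OF g0])
    ultimately show "v \<in> \<phi> ` polys_below (degree g)" by blast
  qed (auto simp: \<phi>_def skew_rem_below f0)
  moreover obtain cs ds where cs: "P.kbasis (polys_below (degree g)) cs" "length cs = degree g * length bs"
    and ds: "P.kbasis (polys_below (degree f)) ds" "length ds = degree f * length bs"
    using kbasis_polys_below[OF assms(1)] by blast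
  moreover have "P.kbasis (\<phi> ` polys_below (degree g)) (map \<phi> cs)"
    unfolding \<phi>_def using right_mult_rem_inj[OF f0 assms(5)]
    by (intro P.kbasis_map klinear_right_mult_rem f0 cs) auto
  ultimately have "length (map \<phi> cs) = length ds"
    using P.kbasis_length_eq by metis
  then show ?thesis
    using cs(2) ds(2) kbasis_UNIV_nonempty[OF assms(1)] by simp
qed

text \<open>If g = u v with both factors nonconstant, then v does not kill b, while u kills the
  nonzero class of v b. But the annihilator of any nonzero class has a generator of degree deg f =
  deg g, which exceeds deg u.\<close>

lemma ann_irreducible:
  assumes "L.kbasis UNIV bs" "skew_irreducible f" "b \<notin> left_mults f" "B \<in> ann f b" "B \<noteq> 0"
  obtains g where "lead_coeff g = 1" "ann f b = left_mults g" "degree g = degree f"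
    "skew_irreducible g"
proof -
  obtain g where g: "lead_coeff g = 1" "ann f b = left_mults g"
    using ann_principal[OF assms(4,5)] by blast
  have deg: "degree g = degree f"
    by (rule degree_ann_generator[OF assms(1-3) g])
  have "degree u = 0 \<or> degree v = 0" if uv: "g = u \<cdot> v" for u v
  proof (rule ccontr)
    assume *: "\<not> ?thesis"
    have "g \<noteq> 0" using g(1) by auto
    then have uv0: "u \<noteq> 0" "v \<noteq> 0" using uv by auto
    then have "degree g = degree u + degree v"
      using uv by (simp add: degree_skew)
    then have less: "degree u < degree g" "degree v < degree g"
      using * by auto
    then have "v \<notin> left_mults g"
      using uv0 left_mults_below[of v g] by (auto simp: polys_below_iff)
    then have vb: "v \<cdot> b \<notin> left_mults f"
      using g(2) by (auto simp: ann_def)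
    have "g \<in> ann f b"
      using g(2) left_mults_self by simp
    then have u: "u \<in> ann f (v \<cdot> b)"
      by (simp add: ann_def uv skew_assoc)
    then obtain g' where g': "lead_coeff g' = 1" "ann f (v \<cdot> b) = left_mults g'"
      using ann_principal uv0 by blast
    have "degree g' = degree f"
      by (rule degree_ann_generator[OF assms(1,2) vb g'])
    then show False
      using left_mults_below[of u g'] u g'(2) less deg uv0 by (simp add: polys_below_iff)
  qed
  then have "skew_irreducible g"
    using deg assms(2) unfolding skew_irreducible_def by simp
  then show ?thesis
    using that g deg by blast
qed

text \<open>The map sends 1 to w, fixes x, ..., x^d and is linear over the big field acting on the
  left, so its determinant over K is that of multiplication by the constant coefficient of
  w.\<close>

lemma det_replace_constant:
  assumes "L.kbasis UNIV bs" "P.kbasis (polys_below d) cs" "w \<in> polys_below (Suc d)"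
    and "L.represents bs A (\<lambda>x. x * coeff w 0)"
  obtains M where "P.represents (map (\<lambda>b. [:b:]) bs @ map (pCons 0) cs) M
      (\<lambda>p. p - [:coeff p 0:] + smult (coeff p 0) w)"
    and "det M = det A"
proof -
  let ?bs = "map (\<lambda>b. [:b:]) bs" and ?cs = "map (pCons 0) cs"
  let ?E = "\<lambda>p. p - [:coeff p 0:] + smult (coeff p 0) w"
  define N where "N = length bs"
  define N' where "N' = length cs"
  obtain a w' where w: "w = pCons a w'" by (rule pCons_cases)
  have "coeff w' i = 0" if "i \<ge> d" for i
    using assms(3) that by (auto simp: w polys_below_def dest: spec[of _ "Suc i"])
  then have w': "w' \<in> polys_below d" by (simp add: polys_below_def)
  have "set (map (\<lambda>b. smult b w') bs) \<subseteq> polys_below d"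
    using w' by (auto intro: polys_below_smult)
  then obtain C where C: "C \<in> carrier_mat N' N" "\<forall>i<N'. \<forall>j<N. C $$ (i, j) \<in> K"
      "\<forall>j<N. map (\<lambda>b. smult b w') bs ! j = P.lincomb (\<lambda>i. C $$ (i, j)) cs"
    using P.base_change[OF assms(2), of "map (\<lambda>b. smult b w') bs" N] by (auto simp: N_def N'_def)
  have A: "A \<in> carrier_mat N N" "\<forall>i<N. \<forall>j<N. A $$ (i, j) \<in> K"
      "\<forall>j<N. bs ! j * a = L.lincomb (\<lambda>i. A $$ (i, j)) bs"
    using assms(4) by (auto simp: L.represents_def N_def w)
  \<comment> \<open>The image b w of a constant b has constant term b a, recorded in A, and tail b
    w', recorded in C; the vectors \<open>pCons 0 c\<close> are fixed.\<close>
  define M where "M = four_block_mat A (0\<^sub>m N N') C (1\<^sub>m N')"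
  have "P.represents (?bs @ ?cs) M ?E"
    unfolding P.represents_def
  proof (intro conjI allI impI)
    show "M \<in> carrier_mat (length (?bs @ ?cs)) (length (?bs @ ?cs))"
      using A(1) C(1) by (simp add: M_def N_def N'_def)
  next
    fix i j assume "i < length (?bs @ ?cs)" "j < length (?bs @ ?cs)"
    then show "M $$ (i, j) \<in> K"
      using A(1,2) C(1,2) by (auto simp: M_def N_def N'_def L.zero_in_K L.one_in_K)
  next
    fix j assume j: "j < length (?bs @ ?cs)"
    have split: "P.lincomb (\<lambda>i. M $$ (i, j)) (?bs @ ?cs) =
        pCons (L.lincomb (\<lambda>i. M $$ (i, j)) bs) (P.lincomb (\<lambda>i. M $$ (i + N, j)) cs)"
      by (simp add: P.lincomb_append lincomb_const lincomb_pCons_0 N_def)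
    show "?E ((?bs @ ?cs) ! j) = P.lincomb (\<lambda>i. M $$ (i, j)) (?bs @ ?cs)"
    proof (cases "j < N")
      case True
      have "L.lincomb (\<lambda>i. M $$ (i, j)) bs = L.lincomb (\<lambda>i. A $$ (i, j)) bs"
        using A(1) C(1) True by (intro L.lincomb_cong) (auto simp: M_def N_def)
      moreover have "P.lincomb (\<lambda>i. M $$ (i + N, j)) cs = P.lincomb (\<lambda>i. C $$ (i, j)) cs"
        using A(1) C(1) True by (intro P.lincomb_cong) (auto simp: M_def N'_def)
      moreover have "?E ((?bs @ ?cs) ! j) = pCons (bs ! j * a) (smult (bs ! j) w')"
        using True by (simp add: nth_append N_def w)
      ultimately show ?thesis
        using A(3) C(3) True by (simp add: split N_def)
    next
      case False
      have jN: "j - N < N'" using False j by (simp add: N_def N'_def)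
      have "L.lincomb (\<lambda>i. M $$ (i, j)) bs = L.lincomb (\<lambda>i. 0) bs"
        using A(1) C(1) False jN by (intro L.lincomb_cong) (auto simp: M_def N_def)
      moreover have "P.lincomb (\<lambda>i. M $$ (i + N, j)) cs =
          P.lincomb (\<lambda>i. 1\<^sub>m N' $$ (i, j - N)) cs"
        using A(1) C(1) False jN by (intro P.lincomb_cong) (auto simp: M_def N'_def)
      moreover have "P.lincomb (\<lambda>i. 1\<^sub>m N' $$ (i, j - N)) cs = cs ! (j - N)"
        using P.represents_id[of cs] jN by (simp add: P.represents_def N'_def)
      moreover have "?E ((?bs @ ?cs) ! j) = pCons 0 (cs ! (j - N))"
        using False jN by (simp add: nth_append N_def N'_def)
      ultimately show ?thesis
        by (simp add: split L.lincomb_def)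
    qed
  qed
  moreover have "det M = det A"
    unfolding M_def using A(1) C(1) by (simp add: det_four_block_mat_upper_right_zero[OF _ refl])
  ultimately show ?thesis by (rule that)
qed

text \<open>Reducing x v modulo f or modulo g subtracts the same scalar multiple:
  \<open>T f v\<close> is x v - c f and \<open>T g v\<close> is x v - c g, where c is \<sigma>
  applied to the top coefficient of v. Hence \<open>T f\<close> is E after \<open>T g\<close> for a
  map E that only replaces the constant term, and conjugacy under right multiplication by b forces
  det E = 1.\<close>

lemma det_similar_constant_quotient:
  assumes "L.kbasis UNIV bs"
    and "lead_coeff f = 1" "lead_coeff g = 1" "degree g = degree f" "degree f > 0"
    and "ann f b = left_mults g" "coeff g 0 \<noteq> 0"
    and "L.represents bs A (\<lambda>x. x * (coeff f 0 / coeff g 0))"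
  shows "det A = 1"
proof -
  have f0: "f \<noteq> 0" and g0: "g \<noteq> 0" using assms(2,3) by auto
  obtain d where d: "degree f = Suc d" using assms(5) by (cases "degree f") auto
  define V where "V = (polys_below (Suc d) :: 'a poly set)"
  obtain cs where cs: "P.kbasis (polys_below d) cs"
    using kbasis_polys_below[OF assms(1)] by blast
  let ?b = "map (\<lambda>b. [:b:]) bs @ map (pCons 0) cs"
  have basis: "P.kbasis V ?b"
    unfolding V_def by (rule kbasis_polys_below_Suc[OF assms(1) cs])
  define T where "T h v = skew_rem \<sigma> (xtimes v) h" for h v
  define \<phi> where "\<phi> v = skew_rem \<sigma> (v \<cdot> b) f" for v
  \<comment> \<open>The constant coefficient of \<open>T g v\<close> is -c g_0, from which c can be
    read off; replacing 1 by this w then subtracts c (f - g). Its constant coefficient is f_0 /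
    g_0.\<close>
  define w where "w = 1 + smult (inverse (coeff g 0)) (f - g)"
  define E where "E p = p - [:coeff p 0:] + smult (coeff p 0) w" for p
  have T_eq: "T h v = xtimes v - smult (\<sigma> (coeff v d)) h"
    if "v \<in> V" "lead_coeff h = 1" "degree h = Suc d" for h v
    unfolding T_def
  proof (rule skew_rem_unique)
    show "xtimes v - (xtimes v - smult (\<sigma> (coeff v d)) h) \<in> left_mults h"
      by (simp add: left_mults_smult left_mults_self)
    have "coeff (xtimes v - smult (\<sigma> (coeff v d)) h) i = 0" if "i \<ge> Suc d" for i
    proof (cases "i = Suc d")
      case True
      then show ?thesis
        using \<open>lead_coeff h = 1\<close> \<open>degree h = Suc d\<close> by (simp add: coeff_xtimes)
    next
      case False
      then show ?thesis
        using that \<open>degree h = Suc d\<close> \<open>v \<in> V\<close>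
        by (auto simp: coeff_xtimes coeff_eq_0 V_def polys_below_def split: nat.split)
    qed
    then show "xtimes v - smult (\<sigma> (coeff v d)) h \<in> polys_below (degree h)"
      by (simp add: polys_below_def that)
  qed
  have T_in: "T h v \<in> V" if "h \<noteq> 0" "degree h = Suc d" for h v
    using skew_rem_below[OF that(1), of "xtimes v"] by (simp add: T_def V_def that)
  have \<phi>_in: "\<phi> v \<in> V" for v
    using skew_rem_below[OF f0, of "v \<cdot> b"] by (simp add: \<phi>_def V_def d)
  \<comment> \<open>A nonzero g_0 makes x act injectively modulo g, so that det \<open>Mg\<close>
    can be cancelled at the end.\<close>
  have Tg_inj: "v = 0" if v: "v \<in> V" "T g v = 0" for v
  proof -
    have eq: "xtimes v = smult (\<sigma> (coeff v d)) g"
      using T_eq[OF v(1) assms(3)] v(2) assms(4) d by simp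
    then have "coeff (xtimes v) 0 = \<sigma> (coeff v d) * coeff g 0" by simp
    then have "\<sigma> (coeff v d) = 0"
      using assms(7) by (simp add: coeff_xtimes)
    then show ?thesis
      using eq by (simp add: xtimes_eq_0_iff)
  qed
  have E_T: "E (T g v) = T f v" if v: "v \<in> V" for v
  proof -
    define c where "c = \<sigma> (coeff v d)"
    have Tg: "T g v = xtimes v - smult c g"
      using T_eq[OF v assms(3)] assms(4) d by (simp add: c_def)
    then have k: "coeff (T g v) 0 = - (c * coeff g 0)"
      by (simp add: coeff_xtimes)
    have "c * coeff g 0 * inverse (coeff g 0) = c"
      using assms(7) by simp
    then have "smult (- (c * coeff g 0)) w = [:- (c * coeff g 0):] - smult c (f - g)"
      by (simp add: w_def smult_add_right one_pCons)
    then have "E (T g v) = T g v - smult c (f - g)"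
      by (simp add: E_def k)
    also have "\<dots> = xtimes v - smult c f"
      by (simp add: Tg smult_diff_right)
    also have "\<dots> = T f v"
      using T_eq[OF v assms(2) d] by (simp add: c_def)
    finally show ?thesis .
  qed
  \<comment> \<open>Multiplication by x on the left commutes with multiplication by b on the
    right.\<close>
  have \<phi>_T: "\<phi> (T g v) = T f (\<phi> v)" for v
  proof -
    have "xtimes v - T g v \<in> ann f b"
      unfolding assms(6) T_def by (rule skew_rem_cong_mod[OF g0])
    then have "xtimes v \<cdot> b - T g v \<cdot> b \<in> left_mults f"
      by (simp add: ann_def skew_diff)
    then have "skew_rem \<sigma> (xtimes v \<cdot> b) f = skew_rem \<sigma> (T g v \<cdot> b) f"
      by (simp add: skew_rem_eq_iff[OF f0])
    then have "\<phi> (T g v) = skew_rem \<sigma> (xtimes v \<cdot> b) f"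
      by (simp add: \<phi>_def)
    also have "\<dots> = T f (\<phi> v)"
    proof -
      have "v \<cdot> b - \<phi> v \<in> left_mults f"
        unfolding \<phi>_def by (rule skew_rem_cong_mod[OF f0])
      from left_mults_mult[OF this, of "[:0, 1:]"]
      have "xtimes v \<cdot> b - xtimes (\<phi> v) \<in> left_mults f"
        by (simp add: skew_diff skew_X_left flip: skew_assoc)
      then show ?thesis
        unfolding T_def by (simp add: skew_rem_eq_iff[OF f0])
    qed
    finally show ?thesis .
  qed
  obtain Mf where Mf: "P.represents ?b Mf (T f)"
    using P.ex_represents[OF basis, of "T f"] T_in[OF f0 d] by blast
  obtain Mg where Mg: "P.represents ?b Mg (T g)"
    using P.ex_represents[OF basis, of "T g"] T_in[OF g0] assms(4) d by auto
  have w_in: "w \<in> polys_below (Suc d)"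
  proof -
    have "coeff (f - g) i = 0" if "i \<ge> Suc d" for i
      using that assms(2-4) d by (cases "i = Suc d") (auto simp: coeff_eq_0)
    then show ?thesis
      by (auto simp: w_def polys_below_def)
  qed
  have "coeff w 0 = coeff f 0 / coeff g 0"
    using assms(7) by (simp add: w_def divide_simps)
  then have "L.represents bs A (\<lambda>x. x * coeff w 0)"
    using assms(8) by simp
  then obtain ME where ME: "P.represents ?b ME E" "det ME = det A"
    unfolding E_def[abs_def] by (rule det_replace_constant[OF assms(1) cs w_in])
  have klinear_T: "P.klinear (T h)" if "h \<noteq> 0" for h
    unfolding T_def by (rule klinear_xtimes_rem[OF that])
  have klinear_E: "P.klinear E"
  proof -
    have "[:k * x:] = smult k [:x:]" "[:x + y:] = [:x:] + [:y:]" for k x y :: 'a by simp_all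
    then show ?thesis
      unfolding P.klinear_def E_def coeff_add coeff_smult
      by (simp add: smult_add_left smult_add_right smult_diff_right del: smult_pCons add_pCons)
  qed
  have "det Mf = det Mg"
  proof (rule P.det_conjugate[OF klinear_T[OF f0] _ basis Mf Mg])
    show "P.klinear \<phi>"
      unfolding \<phi>_def by (rule klinear_right_mult_rem[OF f0])
    show "v = 0" if "v \<in> V" "\<phi> v = 0" for v
      using right_mult_rem_inj[OF f0 assms(6), of v] that assms(4) d by (simp add: V_def \<phi>_def)
  qed (auto simp: \<phi>_in \<phi>_T)
  moreover have "Mf = ME * Mg"
    by (rule P.represents_unique[OF basis Mf P.represents_comp[OF klinear_E ME(1) Mg]])
      (simp add: E_T)
  moreover have "det (ME * Mg) = det ME * det Mg"
    using ME(1) Mg by (intro det_mult) (auto simp: P.represents_def)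
  moreover have "det Mg \<noteq> 0"
    by (rule P.represents_det_nonzero[OF klinear_T[OF g0] basis Mg Tg_inj T_in[OF g0]])
      (auto simp: assms(4) d)
  ultimately show ?thesis
    using ME(2) by simp
qed

end

section \<open>The norm, and the factors of the bound\<close>

context skew_over
begin

declare L.scale_scale [simp del] \<comment> \<open>loops with mult.assoc\<close>

section \<open>The norm of the big field over the subfield\<close>

lemma klinear_mult: "L.klinear (\<lambda>x. a * x)"
  by (simp add: L.klinear_def distrib_left mult.left_commute)

lemma field_norm_eq_det:
  assumes "L.kbasis UNIV bs" "L.represents bs A (\<lambda>x. a * x)"
  shows "field_norm K a = det A"
proof -
  have "field_norm K a = (THE d. \<exists>cs M. L.kbasis UNIV cs \<and> L.represents cs M (\<lambda>x. a * x) \<and> d = det M)"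
    unfolding field_norm_def L.kbasis_def L.represents_def L.lincomb_def by (simp add: conj_assoc)
  also have "\<dots> = det A"
  proof (rule the_equality)
    fix d assume "\<exists>cs M. L.kbasis UNIV cs \<and> L.represents cs M (\<lambda>x. a * x) \<and> d = det M"
    then obtain cs M where cs: "L.kbasis UNIV cs" "L.represents cs M (\<lambda>x. a * x)" "d = det M" by blast
    then show "d = det A"
      using L.det_basis_independent[OF klinear_mult cs(1) assms(1) cs(2) assms(2)] by simp
  qed (use assms in blast)
  finally show ?thesis .
qed

lemma field_norm_mult:
  assumes "L.kbasis UNIV bs"
  shows "field_norm K (a * b) = field_norm K a * field_norm K b"
proof -
  obtain A where A: "L.represents bs A (\<lambda>x. a * x)"
    using L.ex_represents[OF assms, of "\<lambda>x. a * x"] by auto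
  obtain B where B: "L.represents bs B (\<lambda>x. b * x)"
    using L.ex_represents[OF assms, of "\<lambda>x. b * x"] by auto
  have "L.represents bs (A * B) (\<lambda>x. a * b * x)"
    using L.represents_comp[OF klinear_mult A B] by (simp add: comp_def mult.assoc)
  then have "field_norm K (a * b) = det (A * B)"
    by (rule field_norm_eq_det[OF assms])
  also have "\<dots> = det A * det B"
    using A B by (intro det_mult) (auto simp: L.represents_def)
  finally show ?thesis
    using field_norm_eq_det[OF assms A] field_norm_eq_det[OF assms B] by simp
qed

lemma field_norm_one: "L.kbasis UNIV bs \<Longrightarrow> field_norm K 1 = 1"
  using field_norm_eq_det[of bs "1\<^sub>m (length bs)" 1] L.represents_id[of bs] by simp

lemma field_norm_nonzero:
  assumes "L.kbasis UNIV bs" "a \<noteq> 0"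
  shows "field_norm K a \<noteq> 0"
  using field_norm_mult[OF assms(1), of a "inverse a"] field_norm_one[OF assms(1)] assms(2) by auto

text \<open>Matrix entries lie in K and are fixed by \<rho>, so multiplication by \<rho>(a) has in
  the basis \<open>map \<rho> bs\<close> the very matrix that multiplication by a has in
  \<open>bs\<close>.\<close>

lemma field_norm_endo:
  assumes "L.kbasis UNIV bs" "field_endo \<rho>" "\<And>k. k \<in> K \<Longrightarrow> \<rho> k = k"
  shows "field_norm K (\<rho> a) = field_norm K a"
proof -
  interpret rho: field_endo \<rho> by fact
  have klin: "L.klinear \<rho>"
    by (simp add: L.klinear_def rho.endo_add rho.endo_mult assms(3))
  have basis: "L.kbasis UNIV (map \<rho> bs)"
    using L.kbasis_map[OF klin assms(1)] L.klinear_inj_surj[OF klin assms(1)] by simp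
  obtain A where A: "L.represents bs A (\<lambda>x. a * x)"
    using L.ex_represents[OF assms(1), of "\<lambda>x. a * x"] by auto
  have "\<rho> a * map \<rho> bs ! j = L.lincomb (\<lambda>i. A $$ (i, j)) (map \<rho> bs)" if "j < length bs" for j
  proof -
    have "\<rho> a * map \<rho> bs ! j = \<rho> (L.lincomb (\<lambda>i. A $$ (i, j)) bs)"
      using that A by (simp add: L.represents_def flip: rho.endo_mult)
    also have "\<dots> = L.lincomb (\<lambda>i. A $$ (i, j)) (map \<rho> bs)"
      using that A by (intro L.klinear_lincomb[OF klin]) (auto simp: L.represents_def)
    finally show ?thesis .
  qed
  then have "L.represents (map \<rho> bs) A (\<lambda>x. \<rho> a * x)"
    using A by (simp add: L.represents_def)
  then show ?thesis
    using field_norm_eq_det[OF basis] field_norm_eq_det[OF assms(1) A] by simp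
qed

text \<open>The easy half of Hilbert 90: e is the quotient of a by \<rho>(a), and these two have the
  same norm.\<close>

lemma field_norm_eq_1:
  assumes "L.kbasis UNIV bs" "field_endo \<rho>" "\<And>k. k \<in> K \<Longrightarrow> \<rho> k = k"
    and "a \<noteq> 0" "a = e * \<rho> a"
  shows "field_norm K e = 1"
proof -
  have "field_norm K a = field_norm K (e * \<rho> a)"
    using assms(5) by simp
  also have "\<dots> = field_norm K e * field_norm K a"
    by (simp add: field_norm_mult[OF assms(1)] field_norm_endo[OF assms(1-3)])
  finally show ?thesis
    using field_norm_nonzero[OF assms(1,4)] by simp
qed

lemma field_norm_similar:
  assumes "L.kbasis UNIV bs"
    and "lead_coeff f = 1" "lead_coeff g = 1" "degree g = degree f" "degree f > 0"
    and "ann f b = left_mults g" "coeff g 0 \<noteq> 0"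
  shows "field_norm K (coeff f 0) = field_norm K (coeff g 0)"
proof -
  let ?q = "coeff f 0 / coeff g 0"
  obtain A where A: "L.represents bs A (\<lambda>x. ?q * x)"
    using L.ex_represents[OF assms(1), of "\<lambda>x. ?q * x"] by auto
  then have "det A = 1"
    by (intro det_similar_constant_quotient[OF assms]) (simp add: mult.commute)
  then have "field_norm K ?q = 1"
    using field_norm_eq_det[OF assms(1) A] by simp
  then have "field_norm K (?q * coeff g 0) = field_norm K (coeff g 0)"
    by (simp only: field_norm_mult[OF assms(1)]) simp
  then show ?thesis
    using assms(7) by simp
qed

section \<open>Factorizations of the bound into irreducibles\<close>

abbreviation skew_prod :: "'a poly list \<Rightarrow> 'a poly"
  where "skew_prod ps \<equiv> foldr (\<cdot>) ps 1"

lemma skew_prod_append: "skew_prod (ps @ qs) = skew_prod ps \<cdot> skew_prod qs"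
  by (induction ps) (simp_all add: skew_assoc)

lemma degree_skew_prod:
  "skew_prod ps \<noteq> 0 \<Longrightarrow> (\<And>p. p \<in> set ps \<Longrightarrow> degree p = d) \<Longrightarrow> degree (skew_prod ps) = length ps * d"
  by (induction ps) (auto simp: degree_skew)

lemma skew_irreducible_smult:
  assumes "skew_irreducible p" "a \<noteq> 0"
  shows "skew_irreducible (smult a p)"
  unfolding skew_irreducible_def
proof (intro conjI allI impI)
  show "0 < degree (smult a p)"
    using assms by (simp add: skew_irreducible_def)
  fix u v assume "smult a p = u \<cdot> v"
  then have "p = smult (inverse a) u \<cdot> v"
    using assms(2) by (simp add: skew_smult_left flip: \<open>smult a p = u \<cdot> v\<close>)
  then have "degree (smult (inverse a) u) = 0 \<or> degree v = 0"
    using assms(1) unfolding skew_irreducible_def by metis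
  then show "degree u = 0 \<or> degree v = 0"
    using assms(2) by simp
qed

text \<open>Stated for a partial factorization so that induction on deg q goes through: g collects
  the right factors already split off, and q is what remains. The unit u is the rest of q when
  nothing more can be split off.\<close>

lemma bound_quotient_factorization:
  assumes "L.kbasis UNIV bs" "skew_irreducible f" "skew_central B" "B \<noteq> 0" "B \<in> left_mults f"
    and "\<And>g. (\<And>b. g \<cdot> b \<in> left_mults f) \<Longrightarrow> g \<in> left_mults B"
    and "B = q \<cdot> g"
  shows "\<exists>u hs. u \<noteq> 0 \<and> degree u = 0 \<and> q = u \<cdot> skew_prod hs \<and>
    (\<forall>h\<in>set hs. skew_irreducible h \<and> degree h = degree f)"
  using assms(7)
proof (induction "degree q" arbitrary: q g rule: less_induct)
  case less
  have nz: "q \<noteq> 0" "g \<noteq> 0"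
    using less.prems assms(4) by auto
  show ?case
  proof (cases "\<forall>b. g \<cdot> b \<in> left_mults f")
    case True
    \<comment> \<open>If g annihilates R/Rf, then g lies in R B = R q g, so q is a unit and the
      process stops.\<close>
    then have "g \<in> left_mults B"
      using assms(6) by blast
    then obtain r where "g = r \<cdot> (q \<cdot> g)"
      using less.prems by (auto simp: left_mults_def)
    then have "1 \<cdot> g = (r \<cdot> q) \<cdot> g"
      by (simp add: skew_assoc)
    then have "1 = r \<cdot> q"
      by (rule skew_cancel_right[OF _ nz(2)])
    moreover from this have "r \<noteq> 0" by auto
    ultimately have "degree q = 0"
      using nz degree_skew[of r q] by simp
    then show ?thesis
      using nz by (intro exI[of _ q] exI[of _ "[]"]) simp
  next
    case False
    then obtain b where b: "g \<cdot> b \<notin> left_mults f" by blast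
    \<comment> \<open>B = q g kills b, hence q kills the nonzero class of g b, whose annihilator
      provides the next right factor of q.\<close>
    have "q \<cdot> (g \<cdot> b) \<in> left_mults f"
      using central_left_mults[OF assms(3,5), of b] by (simp add: less.prems skew_assoc)
    then have "q \<in> ann f (g \<cdot> b)" by (simp add: ann_def)
    moreover from ann_irreducible[OF assms(1,2) b this nz(1)] obtain h where
      h: "ann f (g \<cdot> b) = left_mults h" "degree h = degree f" "skew_irreducible h" by metis
    ultimately obtain q' where q': "q = q' \<cdot> h" by (auto simp: left_mults_def)
    then have "degree q = degree q' + degree h"
      using nz by (auto intro: degree_skew)
    then have "degree q' < degree q"
      using h(3) by (simp add: skew_irreducible_def)
    moreover have "B = q' \<cdot> (h \<cdot> g)"
      using less.prems by (simp add: q' skew_assoc)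
    ultimately obtain u hs where u: "u \<noteq> 0" "degree u = 0" "q' = u \<cdot> skew_prod hs"
        "\<forall>h\<in>set hs. skew_irreducible h \<and> degree h = degree f"
      using less.hyps[of q' "h \<cdot> g"] by blast
    have "q = u \<cdot> skew_prod (hs @ [h])"
      by (simp only: skew_prod_append) (simp add: q' u(3) skew_assoc)
    then show ?thesis
      using u h by (intro exI[of _ u] exI[of _ "hs @ [h]"]) auto
  qed
qed

lemma bound_factorization:
  assumes "L.kbasis UNIV bs" "skew_irreducible f" "skew_central B" "B \<noteq> 0" "B \<in> left_mults f"
    and "\<And>g. (\<And>b. g \<cdot> b \<in> left_mults f) \<Longrightarrow> g \<in> left_mults B"
  obtains hs where "B = skew_prod hs" "\<And>h. h \<in> set hs \<Longrightarrow> skew_irreducible h"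
    "\<And>h. h \<in> set hs \<Longrightarrow> degree h = degree f"
proof -
  obtain u hs where u: "u \<noteq> 0" "degree u = 0" "B = u \<cdot> skew_prod hs"
      "\<forall>h\<in>set hs. skew_irreducible h \<and> degree h = degree f"
    using bound_quotient_factorization[OF assms, of B 1] by auto
  from assms(5) obtain q where "B = q \<cdot> f" by (auto simp: left_mults_def)
  then have "degree B > 0"
    using assms(2,4) by (auto simp: degree_skew skew_irreducible_def)
  \<comment> \<open>B has positive degree, so there is a first factor to absorb the constant
    u.\<close>
  then obtain h t where hs: "hs = h # t"
    using u(2,3) by (cases hs) auto
  obtain a where a: "u = [:a:]" "a \<noteq> 0"
    using u(1,2) by (auto elim!: degree_eq_zeroE)
  show ?thesis
    by (rule that[of "smult a h # t"])
      (use u(3,4) a in \<open>auto simp: hs skew_const_left skew_smult_left skew_irreducible_smult\<close>)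
qed

text \<open>Let the factors act one by one, from the right end, on the nonzero class of g in R/Rp.
  The whole product kills it, so some h is the first to send a nonzero class to zero. Then h lies in
  the annihilator of that class, which is generated by an irreducible of degree deg p; being
  irreducible, h has this degree too.\<close>

lemma degree_irreducible_right_factor:
  assumes "L.kbasis UNIV bs" "skew_irreducible p"
    and "\<And>h. h \<in> set hs \<Longrightarrow> skew_irreducible h" "\<And>h. h \<in> set hs \<Longrightarrow> degree h = d"
    and "g \<notin> left_mults p" "skew_prod hs \<cdot> g \<in> left_mults p"
  shows "degree p = d"
  using assms(3-6)
proof (induction hs arbitrary: g rule: rev_induct)
  case (snoc h hs)
  have hirr: "skew_irreducible h" and hd: "degree h = d"
    using snoc.prems by auto
  show ?case
  proof (cases "h \<cdot> g \<in> left_mults p")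
    case False
    moreover have "skew_prod hs \<cdot> (h \<cdot> g) \<in> left_mults p"
      using snoc.prems(4) by (simp only: skew_prod_append) (simp add: skew_assoc)
    ultimately show ?thesis
      using snoc.prems(1,2) by (intro snoc.IH) auto
  next
    case True
    then have "h \<in> ann p g" by (simp add: ann_def)
    moreover have "h \<noteq> 0" using hirr by (auto simp: skew_irreducible_def)
    ultimately obtain q where q: "ann p g = left_mults q" "degree q = degree p" "skew_irreducible q"
      using ann_irreducible[OF assms(1,2) snoc.prems(3)] by metis
    with \<open>h \<in> ann p g\<close> obtain v where v: "h = v \<cdot> q" by (auto simp: left_mults_def)
    then have "degree v = 0"
      using hirr q(3) unfolding skew_irreducible_def by (metis less_numeral_extra(3))
    moreover have "degree h = degree v + degree q"
      using v \<open>h \<noteq> 0\<close> by (auto intro: degree_skew)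
    ultimately show ?thesis
      using hd q(2) by simp
  qed
qed simp

lemma degree_irreducible_factor:
  assumes "L.kbasis UNIV bs" "skew_central B" "B \<noteq> 0" "B = skew_prod hs"
    and "\<And>h. h \<in> set hs \<Longrightarrow> skew_irreducible h" "\<And>h. h \<in> set hs \<Longrightarrow> degree h = d"
    and "B = skew_prod ps" "p \<in> set ps" "skew_irreducible p"
  shows "degree p = d"
proof -
  obtain us vs where ps: "ps = us @ p # vs"
    using split_list[OF assms(8)] by blast
  define U where "U = skew_prod us"
  define W where "W = skew_prod vs"
  have B: "B = U \<cdot> (p \<cdot> W)"
    unfolding assms(7) ps U_def W_def by (simp only: skew_prod_append) simp
  \<comment> \<open>a factor in the middle of a central product can be rotated to the right end\<close>
  have "B \<cdot> W = ((W \<cdot> U) \<cdot> p) \<cdot> W"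
    using assms(2) B by (simp add: skew_central_def skew_assoc)
  moreover have "W \<noteq> 0"
    using B assms(3) by auto
  ultimately have "B = (W \<cdot> U) \<cdot> p"
    by (rule skew_cancel_right)
  then have "skew_prod hs \<cdot> 1 \<in> left_mults p"
    using assms(4) by (auto simp: left_mults_def)
  moreover have "1 \<notin> left_mults p"
    using left_mults_below[of 1 p] assms(9) by (auto simp: polys_below_iff skew_irreducible_def)
  ultimately show ?thesis
    using degree_irreducible_right_factor[OF assms(1,9), of hs d 1] assms(5,6) by blast
qed

text \<open>The definite description asks that all factorizations have one length. This comes from
  degrees: every irreducible factor has degree deg f, so the length is deg B / deg f.\<close>

lemma num_irreducible_factors_bound:
  assumes "L.kbasis UNIV bs" "skew_irreducible f" "is_bound \<sigma> f B"
  shows "num_irreducible_factors (skew_poly_ring \<sigma>) B * degree f = degree B"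
proof -
  note bound = is_boundD[OF assms(3)]
  have B0: "B \<noteq> 0" using bound(1) by auto
  obtain hs where hs: "B = skew_prod hs" "\<And>h. h \<in> set hs \<Longrightarrow> skew_irreducible h"
      "\<And>h. h \<in> set hs \<Longrightarrow> degree h = degree f"
    using bound_factorization[OF assms(1,2) bound(2) B0 bound(3,4)] by blast
  have factors: "factors (skew_poly_ring \<sigma>) ps B \<longleftrightarrow>
      (\<forall>p\<in>set ps. skew_irreducible p) \<and> skew_prod ps = B" for ps
    by (simp add: factors_def irreducible_skew_iff) (simp add: skew_poly_ring_def)
  have len: "length ps * degree f = degree B" if "factors (skew_poly_ring \<sigma>) ps B" for ps
  proof -
    have ps: "B = skew_prod ps" "\<And>p. p \<in> set ps \<Longrightarrow> skew_irreducible p"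
      using that by (auto simp: factors)
    have "degree p = degree f" if "p \<in> set ps" for p
      by (rule degree_irreducible_factor[OF assms(1) bound(2) B0 hs ps(1) that ps(2)[OF that]])
    then show ?thesis
      using degree_skew_prod[of ps "degree f"] B0 that by (auto simp: factors)
  qed
  have "factors (skew_poly_ring \<sigma>) hs B"
    unfolding factors using hs by simp
  have "num_irreducible_factors (skew_poly_ring \<sigma>) B = length hs"
    unfolding num_irreducible_factors_def
  proof (rule the_equality)
    show "\<exists>fs. set fs \<subseteq> carrier (skew_poly_ring \<sigma>) \<and> factors (skew_poly_ring \<sigma>) fs B \<and>
        length fs = length hs"
      using \<open>factors (skew_poly_ring \<sigma>) hs B\<close>
      by (intro exI[of _ hs]) (simp add: skew_poly_ring_def)
    fix m assume "\<exists>fs. set fs \<subseteq> carrier (skew_poly_ring \<sigma>) \<and>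
        factors (skew_poly_ring \<sigma>) fs B \<and> length fs = m"
    then have "m * degree f = length hs * degree f"
      using len \<open>factors (skew_poly_ring \<sigma>) hs B\<close> by force
    then show "m = length hs"
      using assms(2) by (simp add: skew_irreducible_def)
  qed
  then show ?thesis
    using len \<open>factors (skew_poly_ring \<sigma>) hs B\<close> by simp
qed

end

section \<open>The division algebra\<close>

context skew_over
begin

lemma skew_add_mult_below_zero:
  assumes "L.kbasis UNIV bs" "field_endo \<rho>" "\<And>k. k \<in> K \<Longrightarrow> \<rho> k = k"
    and f: "skew_irreducible f" "lead_coeff f = 1"
    and B: "skew_central B" "B \<noteq> 0" "B \<in> left_mults f"
    and norm: "field_norm K (\<eta> * coeff f 0) \<noteq> 1"
    and u: "u \<in> polys_below (degree f)" "coeff u 0 = a - \<eta> * \<rho> a * coeff f 0"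
    and b: "b \<in> polys_below (degree f)" "b \<noteq> 0"
    and zero: "(u + smult (\<eta> * \<rho> a) f) \<cdot> b \<in> left_mults f"
  shows "u = 0"
proof -
  interpret rho: field_endo \<rho> by fact
  define c where "c = \<eta> * \<rho> a"
  have "b \<notin> left_mults f"
    using b left_mults_below by blast
  moreover have "B \<in> ann f b"
    using B by (simp add: ann_def central_left_mults)
  ultimately obtain g where g: "lead_coeff g = 1" "ann f b = left_mults g" "degree g = degree f"
    using ann_irreducible[OF assms(1) f(1) _ _ B(2)] by metis
  have "u + smult c f \<in> left_mults g"
    using zero g(2) by (auto simp: ann_def c_def)
  \<comment> \<open>f and g are monic of equal degree, so subtracting c g cancels the top
    coefficient and leaves a left multiple of g of degree below deg g.\<close>
  then have "u + smult c f - smult c g \<in> left_mults g"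
    by (intro left_mults_diff left_mults_smult left_mults_self)
  then have "u + smult c (f - g) \<in> left_mults g"
    by (simp add: smult_diff_right add_diff_eq)
  moreover have "f - g \<in> polys_below (degree f)"
    using f(2) g(1,3) by (auto simp: polys_below_def le_less coeff_eq_0)
  then have "u + smult c (f - g) \<in> polys_below (degree g)"
    using u(1) g(3) by (simp add: polys_below_add polys_below_smult)
  ultimately have eq: "u + smult c (f - g) = 0"
    by (rule left_mults_below)
  \<comment> \<open>For c = 0 the equation already reads u = 0. Otherwise a is nonzero, and then so
    is g_0, as the comparison of norms requires.\<close>
  show ?thesis
  proof (cases "c = 0")
    case False
    then have a: "a \<noteq> 0" by (auto simp: c_def)
    have "coeff (u + smult c (f - g)) 0 = 0"
      by (simp add: eq)
    then have a_eq: "a = (\<eta> * coeff g 0) * \<rho> a"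
      using u(2) by (simp add: c_def algebra_simps)
    with a have g0: "coeff g 0 \<noteq> 0" by auto
    have "field_norm K (\<eta> * coeff g 0) = 1"
      by (rule field_norm_eq_1[OF assms(1-3) a a_eq])
    moreover have "field_norm K (coeff f 0) = field_norm K (coeff g 0)"
      using f(1) field_norm_similar[OF assms(1) f(2) g(1,3) _ g(2) g0]
      by (simp add: skew_irreducible_def)
    ultimately show ?thesis
      using norm by (simp add: field_norm_mult[OF assms(1)])
  qed (use eq in simp)
qed

text \<open>A kernel element y \<noteq> 0 would give e = y / \<rho>(y), which has norm 1.\<close>

lemma bij_twist:
  assumes "L.kbasis UNIV bs" "field_endo \<rho>" "\<And>k. k \<in> K \<Longrightarrow> \<rho> k = k" "field_norm K e \<noteq> 1"
  shows "bij (\<lambda>y. y - e * \<rho> y)"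
proof -
  interpret rho: field_endo \<rho> by fact
  have klin: "L.klinear (\<lambda>y. y - e * \<rho> y)"
    by (simp add: L.klinear_def rho.endo_add rho.endo_mult assms(3) algebra_simps)
  have zero: "y = 0" if "y - e * \<rho> y = 0" for y
    using field_norm_eq_1[OF assms(1-3), of y e] that assms(4) by auto
  have "inj (\<lambda>y. y - e * \<rho> y)"
  proof (rule injI)
    fix x y assume "x - e * \<rho> x = y - e * \<rho> y"
    then have "(x - y) - e * \<rho> (x - y) = 0"
      by (simp add: rho.endo_diff algebra_simps)
    from zero[OF this] show "x = y" by simp
  qed
  moreover have "surj (\<lambda>y. y - e * \<rho> y)"
    using L.klinear_inj_surj[OF klin assms(1)] zero by auto
  ultimately show ?thesis
    by (simp add: bij_def)
qed

lemma division_algebra_star: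
  assumes basis: "L.kbasis UNIV bs" and rho: "field_endo \<rho>" "\<And>k. k \<in> K \<Longrightarrow> \<rho> k = k"
    and f: "skew_irreducible f" "lead_coeff f = 1"
    and B: "skew_central B" "B \<noteq> 0" "B \<in> left_mults f"
    and norm: "field_norm K (\<eta> * coeff f 0) \<noteq> 1"
  shows "nonassoc_division_algebra (skew_poly_ring \<sigma>) ((\<lambda>k. [:k:]) ` K) (residue_polys f)
      (star_mult \<sigma> \<rho> \<eta> f)"
proof -
  interpret rho: field_endo \<rho> by fact
  have f0: "f \<noteq> 0" using f(2) by auto
  define V where "V = (polys_below (degree f) :: 'a poly set)"
  define \<theta> where "\<theta> y = y - \<eta> * \<rho> y * coeff f 0" for y
  define star where "star = star_mult \<sigma> \<rho> \<eta> f"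
  \<comment> \<open>This is the coefficient a_0 of the presentation in the theorem, recovered from
    the constant term a_0 - \<eta> \<rho>(a_0) f_0.\<close>
  define \<alpha> where "\<alpha> u = inv_into UNIV \<theta> (coeff u 0)" for u
  obtain cs where cs: "P.kbasis V cs"
    using kbasis_polys_below[OF basis] unfolding V_def by blast
  have bij: "bij \<theta>"
    using bij_twist[OF basis rho norm] by (simp add: \<theta>_def[abs_def] ac_simps)
  have \<theta>_add: "\<theta> (x + y) = \<theta> x + \<theta> y" for x y
    by (simp add: \<theta>_def rho.endo_add algebra_simps)
  have \<theta>_mult: "\<theta> (k * y) = k * \<theta> y" if "k \<in> K" for k y
    by (simp add: \<theta>_def rho.endo_mult rho(2)[OF that] algebra_simps)
  have \<theta>_\<alpha>: "\<theta> (\<alpha> u) = coeff u 0" for u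
    using bij by (simp add: \<alpha>_def bij_is_surj surj_f_inv_f)
  have \<theta>_inject: "\<theta> x = \<theta> y \<Longrightarrow> x = y" for x y
    using bij by (simp add: bij_def inj_eq)
  have \<alpha>_add: "\<alpha> (u + v) = \<alpha> u + \<alpha> v" for u v
    by (rule \<theta>_inject) (simp add: \<theta>_add \<theta>_\<alpha>)
  have \<alpha>_smult: "\<alpha> (smult k u) = k * \<alpha> u" if "k \<in> K" for k u
    by (rule \<theta>_inject) (simp add: \<theta>_mult[OF that] \<theta>_\<alpha>)
  \<comment> \<open>The representative of u modulo f whose constant coefficient is
    \<open>\<alpha> u\<close>. Its linearity over the subfield makes the product linear in the first
    argument.\<close>
  define lift where "lift u = u + smult (\<eta> * \<rho> (\<alpha> u)) f" for u
  have star_eq: "star u b = skew_rem \<sigma> (lift u \<cdot> b) f" for u b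
  proof -
    have "(THE y. y - \<eta> * \<rho> y * coeff f 0 = coeff u 0) = \<alpha> u"
    proof (rule the_equality)
      show "y = \<alpha> u" if "y - \<eta> * \<rho> y * coeff f 0 = coeff u 0" for y
        by (rule \<theta>_inject) (unfold \<theta>_\<alpha>, simp add: \<theta>_def that)
    qed (use \<theta>_\<alpha>[of u] in \<open>simp add: \<theta>_def\<close>)
    then show ?thesis
      by (simp add: star_def star_mult_def lift_def)
  qed
  have lift_add: "lift (u + v) = lift u + lift v" for u v
    by (simp add: lift_def \<alpha>_add rho.endo_add distrib_left smult_add_left)
  have lift_smult: "lift (smult k u) = smult k (lift u)" if "k \<in> K" for k u
    by (simp add: lift_def \<alpha>_smult[OF that] rho.endo_mult rho(2)[OF that] smult_add_right ac_simps)
  have in_V: "star u b \<in> V" for u b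
    unfolding V_def star_eq by (rule skew_rem_below[OF f0])
  have add_left: "star (u + v) b = star u b + star v b"
    and add_right: "star u (b + c) = star u b + star u c" for u v b c
    by (simp_all add: star_eq lift_add skew_add_left skew_add_right skew_rem_add f0)
  have smult_left: "star (smult k u) b = smult k (star u b)"
    and smult_right: "star u (smult k b) = smult k (star u b)" if "k \<in> K" for k u b
    by (simp_all add: star_eq lift_smult[OF that] skew_smult_left
        skew_smult_fixed[OF fixed[OF that]] skew_rem_smult f0)
  have no_zero_div: "u = 0" if "u \<in> V" "b \<in> V" "b \<noteq> 0" "star u b = 0" for u b
  proof (rule skew_add_mult_below_zero[OF basis rho f B norm])
    show "u \<in> polys_below (degree f)" "b \<in> polys_below (degree f)" "b \<noteq> 0"
      using that by (auto simp: V_def)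
    show "coeff u 0 = \<alpha> u - \<eta> * \<rho> (\<alpha> u) * coeff f 0"
      using \<theta>_\<alpha>[of u] by (simp add: \<theta>_def)
    show "(u + smult (\<eta> * \<rho> (\<alpha> u)) f) \<cdot> b \<in> left_mults f"
      using that(4) by (simp add: star_eq skew_rem_eq_0_iff f0 lift_def)
  qed
  have bij_klinear: "bij_betw T V V"
    if "P.klinear T" "\<And>v. v \<in> V \<Longrightarrow> T v = 0 \<Longrightarrow> v = 0" "\<And>v. T v \<in> V" for T
  proof -
    have "inj_on T V"
    proof (rule inj_onI)
      fix x y assume xy: "x \<in> V" "y \<in> V" "T x = T y"
      then have "T (x - y) = 0"
        by (simp add: P.klinear_diff[OF that(1)])
      moreover have "x - y \<in> V"
        using xy unfolding V_def by (blast intro: polys_below_diff)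
      ultimately show "x = y"
        using that(2) by force
    qed
    then show ?thesis
      using P.klinear_inj_surj[OF that(1) cs that(2,3)] by (simp add: bij_betw_def)
  qed
  have bij_right: "bij_betw (star a) V V" if "a \<in> V" "a \<noteq> 0" for a
  proof (rule bij_klinear)
    show "b = 0" if "b \<in> V" "star a b = 0" for b
      using no_zero_div[of a b] that \<open>a \<in> V\<close> \<open>a \<noteq> 0\<close> by blast
  qed (auto simp: P.klinear_def add_right smult_right in_V)
  have bij_left: "bij_betw (\<lambda>b. star b a) V V" if "a \<in> V" "a \<noteq> 0" for a
  proof (rule bij_klinear)
    show "b = 0" if "b \<in> V" "star b a = 0" for b
      using no_zero_div[of b a] that \<open>a \<in> V\<close> \<open>a \<noteq> 0\<close> by blast
  qed (auto simp: P.klinear_def add_left smult_left in_V)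
  have fin: "ring.finite_dimension (skew_poly_ring \<sigma>) ((\<lambda>k. [:k:]) ` K) V"
    using P.kbasis_dimension[OF cs] ring.finite_dimensionI[OF skew_ring] by blast
  show ?thesis
    unfolding nonassoc_division_algebra_def residue_polys_eq star_def[symmetric] V_def[symmetric]
  proof (intro conjI)
    show "subalgebra ((\<lambda>k. [:k:]) ` K) V (skew_poly_ring \<sigma>)"
      by (rule ring.finite_dimension_imp_subalgebra[OF skew_ring P.subfield_image fin])
  qed (auto simp: in_V add_left add_right smult_left smult_right bij_left bij_right P.action
      intro: skew_ring P.subfield_image fin)
qed

end

section \<open>Instantiation at the fixed field K' and the dimension count\<close>

lemma field_endo_ring_iso:
  assumes "\<tau> \<in> ring_iso type_ring type_ring"
  shows "field_endo \<tau>"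
  using ring_iso_memE(2-4)[OF assms]
  by unfold_locales (auto simp: ring_of_type_algebra_def)

lemma subfield_fixed_inter:
  assumes "subfield K type_ring" "field_endo \<rho>"
  shows "subfield ({a. \<rho> a = a} \<inter> K) type_ring"
proof -
  interpret rho: field_endo \<rho> by fact
  interpret T: Ring.field "type_ring :: 'a ring" by (rule field_from_type_algebra)
  have minus: "\<ominus>\<^bsub>type_ring\<^esub> a = - a" for a :: 'a
    by (rule T.minus_equality) (auto simp: ring_of_type_algebra_def)
  have inv: "inv\<^bsub>type_ring\<^esub> a = inverse a" if "a \<noteq> 0" for a :: 'a
    by (rule T.inv_unique'[symmetric]) (use that in \<open>auto simp: ring_of_type_algebra_def\<close>)
  note K = subringE[OF subfieldE(1)[OF assms(1)]]
  have one: "1 \<in> K" and add: "a \<in> K \<Longrightarrow> b \<in> K \<Longrightarrow> a + b \<in> K"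
    and mult: "a \<in> K \<Longrightarrow> b \<in> K \<Longrightarrow> a * b \<in> K" and uminus: "a \<in> K \<Longrightarrow> - a \<in> K" for a b
    using K K(5)[unfolded minus] by (auto simp: ring_of_type_algebra_def)
  have inverse: "inverse a \<in> K" if "a \<in> K" "a \<noteq> 0" for a
    using T.subfield_m_inv(1)[OF assms(1), of a] inv[of a] that by (simp add: ring_of_type_algebra_def)
  show ?thesis
  proof (rule T.subfieldI')
    show "subring ({a. \<rho> a = a} \<inter> K) type_ring"
    proof (rule T.subringI, unfold minus)
    qed (auto simp: ring_of_type_algebra_def rho.endo_uminus rho.endo_add rho.endo_mult
        one add mult uminus)
  next
    fix k assume "k \<in> {a. \<rho> a = a} \<inter> K - {\<zero>\<^bsub>type_ring\<^esub>}"
    then have k: "\<rho> k = k" "k \<in> K" "k \<noteq> 0"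
      by (auto simp: ring_of_type_algebra_def)
    then have "k * \<rho> (inverse k) = 1"
      using rho.endo_mult[of k "inverse k"] by simp
    then have "\<rho> (inverse k) = inverse k"
      by (metis inverse_unique)
    then show "inv\<^bsub>type_ring\<^esub> k \<in> {a. \<rho> a = a} \<inter> K"
      using k by (simp add: inv inverse)
  qed
qed

theorem mainTheorem10:
  fixes K K' :: "'a::field set" and \<sigma> \<rho> :: "'a \<Rightarrow> 'a" and \<eta> :: 'a
    and f F :: "'a poly" and n m l s :: nat
  assumes galois: "galois_extension K"
    and degree_n: "ring.dimension type_ring n K UNIV" and "n \<ge> 2"
    and sigma: "\<sigma> \<in> carrier (galois_group K)"
    and generator: "generate (galois_group K) {\<sigma>} = carrier (galois_group K)"
    and "Polynomial.lead_coeff f = 1"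
    and "ring_irreducible\<^bsub>skew_poly_ring \<sigma>\<^esub> f"
    and "f \<notin> ring_center (skew_poly_ring \<sigma>)"
    and bound: "is_bound \<sigma> f (power_subst n F)"
    and "F \<in> carrier (poly_ring_over K)"
    and "Polynomial.lead_coeff F = 1"
    and "ring_irreducible\<^bsub>poly_ring_over K\<^esub> F"
    and "Polynomial.degree F = s"
    and "F \<noteq> [:0, 1:]"
    and m: "m = num_irreducible_factors (skew_poly_ring \<sigma>) (power_subst n F)"
    and l: "l = n div m"
    and "Polynomial.degree f = s * l"
    and rho: "\<rho> \<in> ring_iso type_ring type_ring"
    and K': "K' = {a. \<rho> a = a} \<inter> K"
    and "ring.finite_dimension type_ring K' K"
    and norm: "field_norm K' (\<eta> * poly.coeff f 0) \<noteq> 1"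
  shows "bij (\<lambda>y. y - \<eta> * \<rho> y * poly.coeff f 0) \<and>
    nonassoc_division_algebra (skew_poly_ring \<sigma>) ((\<lambda>k. [:k:]) ` K') (residue_polys f)
      (star_mult \<sigma> \<rho> \<eta> f) \<and>
    ring.dimension (skew_poly_ring \<sigma>) (m * l^2 * s * ring.dim type_ring K' K)
      ((\<lambda>k. [:k:]) ` K') (residue_polys f)"
proof -
  interpret T: Ring.field "type_ring :: 'a ring" by (rule field_from_type_algebra)
  have sigma_iso: "\<sigma> \<in> ring_iso type_ring type_ring" "\<And>k. k \<in> K \<Longrightarrow> \<sigma> k = k"
    using sigma by (auto simp: galois_group_def)
  have subfield_K: "subfield K type_ring"
    using galois by (simp add: galois_extension_def)
  have rho_endo: "field_endo \<rho>" and sigma_endo: "field_endo \<sigma>"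
    using rho sigma_iso(1) by (auto intro: field_endo_ring_iso)
  have subfield_K': "subfield K' type_ring"
    unfolding K' by (rule subfield_fixed_inter[OF subfield_K rho_endo])
  interpret skew_over \<sigma> K'
  proof (intro skew_over.intro skew_over_axioms.intro)
    show "\<sigma> k = k" if "k \<in> K'" for k
      using that sigma_iso(2) by (simp add: K')
  qed (use sigma_endo subfield_K' in auto)
  have rho_fixed: "\<rho> k = k" if "k \<in> K'" for k
    using that by (simp add: K')
  define D where "D = ring.dim type_ring K' K"
  have "T.dimension D K' K"
    using T.finite_dimensionE[OF subfield_K' assms(20)] by (simp add: D_def over_def)
  \<comment> \<open>Degrees multiply in the tower K' \<subseteq> K \<subseteq> UNIV.\<close>
  then have "T.dimension (D * n) K' UNIV"
    by (rule T.telescopic_base[OF subfield_K' subfield_K _ degree_n])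
  then obtain bs where bs: "L.kbasis UNIV bs" "length bs = D * n"
    using L.dimension_kbasis[of "D * n" UNIV] by auto
  have f_irr: "skew_irreducible f"
    using assms(7) irreducible_skew_iff by (simp add: ring_irreducible_def)
  note boundD = is_boundD[OF bound]
  have B0: "power_subst n F \<noteq> 0"
    using boundD(1) by auto
  \<comment> \<open>m deg f = deg F(x^n) = s n together with deg f = s l forces m l = n, so
    \<open>n div m\<close> is an exact quotient.\<close>
  have "m * degree f = degree (power_subst n F)"
    unfolding m by (rule num_irreducible_factors_bound[OF bs(1) f_irr bound])
  also have "\<dots> = s * n"
    using assms(13) by (simp add: power_subst_def degree_pcompose degree_monom_eq)
  finally have "s * (m * l) = s * n"
    by (simp add: assms(17) ac_simps)
  moreover have "s > 0"
    using f_irr assms(17) by (cases s) (auto simp: skew_irreducible_def)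
  ultimately have ml: "m * l = n" by simp
  obtain cs where cs: "P.kbasis (residue_polys f) cs" "length cs = degree f * length bs"
    using kbasis_polys_below[OF bs(1)] unfolding residue_polys_eq by blast
  \<comment> \<open>The dimension is deg f times [UNIV : K'], that is s l times D n; substituting n
    = m l produces the square of l.\<close>
  have "length cs = m * l^2 * s * D"
    by (simp add: cs(2) bs(2) assms(17) power2_eq_square flip: ml)
  then have "ring.dimension (skew_poly_ring \<sigma>) (m * l^2 * s * D) ((\<lambda>k. [:k:]) ` K') (residue_polys f)"
    using P.kbasis_dimension[OF cs(1)] by simp
  moreover have "bij (\<lambda>y. y - \<eta> * \<rho> y * coeff f 0)"
    using bij_twist[OF bs(1) rho_endo rho_fixed norm] by (simp add: ac_simps)
  moreover have "nonassoc_division_algebra (skew_poly_ring \<sigma>) ((\<lambda>k. [:k:]) ` K') (residue_polys f)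
      (star_mult \<sigma> \<rho> \<eta> f)"
    by (rule division_algebra_star[OF bs(1) rho_endo rho_fixed f_irr assms(6) boundD(2) B0
          boundD(3) norm])
  ultimately show ?thesis
    by (simp add: D_def)
qed

end
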